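(* Let $n\ge 1$, write points of $\mathbb{R}^{n+1}$ as $(t,y)\in\mathbb{R}\times\mathbb{R}^n$, and let $P=\partial_t^2-\Delta_y$, regarded as the unique self-adjoint extension in $L^2(\mathbb{R}^{n+1})$ of this operator on $C_c^\infty(\mathbb{R}^{n+1})$. Then for every $\varepsilon>0$ there exists $f\in L^2(\mathbb{R}^{n+1})$ such that $(P-i)^{-1}f\notin H^{\frac12+\varepsilon}_{\mathrm{loc}}(\mathbb{R}^{n+1})$.
   Context: $P=\partial_t^2-\Delta_y$ is essentially self-adjoint on $C_c^\infty(\mathbb{R}^{n+1})$ (a well-known fact), so $(P-i)^{-1}$ is a bounded operator on $L^2(\mathbb{R}^{n+1})$. $H^k(\mathbb{R}^{n+1})=\langle D\rangle^{-k}L^2(\mathbb{R}^{n+1})$ is the usual $L^2$-based Sobolev space, and $H^k_{\mathrm{loc}}$ is the set of distributions $u$ with $\chi u\in H^k$ for all $\chi\in C_c^\infty$. *)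

theory Defs
  imports "HOL-Analysis.Analysis"
begin

section \<open>Smooth functions, test functions, Schwartz functions\<close>

text \<open>
  For a list \<open>bs\<close> of basis vectors, \<open>iter_pd bs f\<close> is the mixed partial derivative of \<open>f\<close> along
  the entries of \<open>bs\<close> (the last entry is applied first), so \<open>length bs\<close> is its order.
\<close>

primrec iter_pd :: "'a list \<Rightarrow> ('a::euclidean_space \<Rightarrow> complex) \<Rightarrow> 'a \<Rightarrow> complex" where
  "iter_pd [] f = f"
| "iter_pd (b # bs) f = (\<lambda>x. frechet_derivative (iter_pd bs f) (at x) b)"

definition smooth :: "('a::euclidean_space \<Rightarrow> complex) \<Rightarrow> bool" where
  "smooth f \<longleftrightarrow> (\<forall>bs\<in>lists Basis. \<forall>x. iter_pd bs f differentiable (at x))"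

definition test_functions :: "('a::euclidean_space \<Rightarrow> complex) set" where
  "test_functions = {\<phi>. smooth \<phi> \<and> compact (closure {x. \<phi> x \<noteq> 0})}"

definition schwartz_functions :: "('a::euclidean_space \<Rightarrow> complex) set" where
  "schwartz_functions = {\<phi>. smooth \<phi> \<and>
     (\<forall>k. \<forall>bs\<in>lists Basis. bounded (range (\<lambda>x. of_real ((1 + norm x) ^ k) * iter_pd bs \<phi> x)))}"


section \<open>Square-integrable functions and unbounded operators\<close>

text \<open>
  Elements of \<open>L\<^sup>2\<close> are represented by functions. An unbounded operator is represented by its
  graph, a set of pairs of representatives. The adjoint of any graph is a linear relation that is
  closed under almost-everywhere modification of either component, and hence so is every
  self-adjoint operator.
\<close>

definition L2 :: "('a::euclidean_space \<Rightarrow> complex) set" where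
  "L2 = {f. f \<in> borel_measurable lborel \<and> integrable lborel (\<lambda>x. (cmod (f x))\<^sup>2)}"

definition L2_inner :: "('a::euclidean_space \<Rightarrow> complex) \<Rightarrow> ('a \<Rightarrow> complex) \<Rightarrow> complex" where
  "L2_inner f g = (LINT x|lborel. f x * cnj (g x))"

definition L2_norm :: "('a::euclidean_space \<Rightarrow> complex) \<Rightarrow> real" where
  "L2_norm f = sqrt (LINT x|lborel. (cmod (f x))\<^sup>2)"

definition densely_defined :: "('a::euclidean_space \<Rightarrow> complex) rel \<Rightarrow> bool" where
  "densely_defined T \<longleftrightarrow> (\<forall>f\<in>L2. \<forall>e>0. \<exists>u\<in>Domain T. L2_norm (\<lambda>x. f x - u x) < e)"

definition op_adjoint :: "('a::euclidean_space \<Rightarrow> complex) rel \<Rightarrow> ('a \<Rightarrow> complex) rel" where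
  "op_adjoint T = {(v, w). v \<in> L2 \<and> w \<in> L2 \<and> (\<forall>(u, f)\<in>T. L2_inner f v = L2_inner u w)}"

text \<open>
  Linearity and single-valuedness (up to null sets) are not listed below because they follow: the
  former from \<open>T = T\<^sup>*\<close>, the latter from \<open>T = T\<^sup>*\<close> together with density of the domain.
\<close>

definition self_adjoint :: "('a::euclidean_space \<Rightarrow> complex) rel \<Rightarrow> bool" where
  "self_adjoint T \<longleftrightarrow> T \<subseteq> L2 \<times> L2 \<and> densely_defined T \<and> op_adjoint T = T"

text \<open>The graph of \<open>(T - z)\<^sup>-\<^sup>1\<close>.\<close>

definition resolvent :: "('a::euclidean_space \<Rightarrow> complex) rel \<Rightarrow> complex \<Rightarrow> ('a \<Rightarrow> complex) rel" where
  "resolvent T z = {(\<lambda>x. g x - z * u x, u) | u g. (u, g) \<in> T}"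


section \<open>The wave operator on test functions\<close>

definition wave :: "(real \<times> (real^'n) \<Rightarrow> complex) \<Rightarrow> real \<times> (real^'n) \<Rightarrow> complex" where
  "wave \<phi> x = iter_pd [(1, 0), (1, 0)] \<phi> x
     - (\<Sum>b\<in>(Basis :: (real^'n) set). iter_pd [(0, b), (0, b)] \<phi> x)"

text \<open>
  The wave operator is essentially self-adjoint on the test functions, so exactly one \<open>T\<close> satisfies
  the following predicate.
\<close>

definition self_adjoint_extension_of_wave :: "(real \<times> (real^'n) \<Rightarrow> complex) rel \<Rightarrow> bool" where
  "self_adjoint_extension_of_wave T \<longleftrightarrow>
     self_adjoint T \<and> (\<forall>\<phi>\<in>test_functions. (\<phi>, wave \<phi>) \<in> T)"


section \<open>Distributions\<close>

text \<open>
  Distributions are functionals on functions of which only the values on test functions (for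
  tempered distributions: on Schwartz functions) are meaningful. In \<open>distribution\<close>, continuity is
  the usual seminorm estimate on each compact set, the bound \<open>M\<close> standing for the maximum of the
  supremum norms of the derivatives of order at most \<open>N\<close>.
\<close>

type_synonym 'a functional = "('a \<Rightarrow> complex) \<Rightarrow> complex"

definition distribution :: "'a::euclidean_space functional \<Rightarrow> bool" where
  "distribution u \<longleftrightarrow>
     (\<forall>\<phi>\<in>test_functions. \<forall>\<psi>\<in>test_functions. \<forall>a b.
        u (\<lambda>x. a * \<phi> x + b * \<psi> x) = a * u \<phi> + b * u \<psi>) \<and>
     (\<forall>K. compact K \<longrightarrow> (\<exists>C\<ge>0. \<exists>N. \<forall>\<phi>\<in>test_functions. \<forall>M. {x. \<phi> x \<noteq> 0} \<subseteq> K \<longrightarrow>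
        (\<forall>bs\<in>lists Basis. length bs \<le> N \<longrightarrow> (\<forall>x. cmod (iter_pd bs \<phi> x) \<le> M)) \<longrightarrow>
        cmod (u \<phi>) \<le> C * M))"

definition distr_of_fun :: "('a::euclidean_space \<Rightarrow> complex) \<Rightarrow> 'a functional" where
  "distr_of_fun f = (\<lambda>\<phi>. LINT x|lborel. f x * \<phi> x)"

definition mult_distr :: "('a::euclidean_space \<Rightarrow> complex) \<Rightarrow> 'a functional \<Rightarrow> 'a functional" where
  "mult_distr \<theta> u = (\<lambda>\<phi>. u (\<lambda>x. \<theta> x * \<phi> x))"


section \<open>Fourier transform and Sobolev spaces\<close>

definition fourier :: "('a::euclidean_space \<Rightarrow> complex) \<Rightarrow> 'a \<Rightarrow> complex" where
  "fourier \<phi> \<xi> = (LINT x|lborel. exp (- \<i> * of_real (x \<bullet> \<xi>)) * \<phi> x)"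

definition fourier_distr :: "'a::euclidean_space functional \<Rightarrow> 'a functional" where
  "fourier_distr u = (\<lambda>\<phi>. u (fourier \<phi>))"

definition japanese_bracket :: "'a::euclidean_space \<Rightarrow> real" where
  "japanese_bracket \<xi> = sqrt (1 + (norm \<xi>)\<^sup>2)"

text \<open>
  \<open>L2_fourier g h\<close>: the Fourier transform of \<open>g \<in> L\<^sup>2\<close>, taken in the sense of tempered
  distributions, is \<open>h \<in> L\<^sup>2\<close>. By Plancherel's theorem every \<open>g\<close> has such an \<open>h\<close>, unique almost
  everywhere.
\<close>

definition L2_fourier :: "('a::euclidean_space \<Rightarrow> complex) \<Rightarrow> ('a \<Rightarrow> complex) \<Rightarrow> bool" where
  "L2_fourier g h \<longleftrightarrow> g \<in> L2 \<and> h \<in> L2 \<and>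
     (\<forall>\<phi>\<in>schwartz_functions. fourier_distr (distr_of_fun g) \<phi> = distr_of_fun h \<phi>)"

text \<open>
  \<open>H\<^sup>s = \<langle>D\<rangle>\<^sup>-\<^sup>s L\<^sup>2\<close> with \<open>D = -i\<partial>\<close>: a tempered distribution \<open>u\<close> equals \<open>\<langle>D\<rangle>\<^sup>-\<^sup>s g\<close> iff its Fourier
  transform is \<open>\<langle>\<xi>\<rangle>\<^sup>-\<^sup>s\<close> times the Fourier transform of \<open>g\<close>. As the Fourier transform maps the Schwartz
  space onto itself, this condition determines \<open>u\<close> on all Schwartz functions.
\<close>

definition sobolev :: "real \<Rightarrow> ('a::euclidean_space functional) set" where
  "sobolev s = {u. \<exists>g h. L2_fourier g h \<and>
     (\<forall>\<phi>\<in>schwartz_functions.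
        fourier_distr u \<phi> =
          distr_of_fun (\<lambda>\<xi>. of_real (japanese_bracket \<xi> powr (- s)) * h \<xi>) \<phi>)}"

definition sobolev_loc :: "real \<Rightarrow> ('a::euclidean_space functional) set" where
  "sobolev_loc s = {u. distribution u \<and> (\<forall>\<theta>\<in>test_functions. mult_distr \<theta> u \<in> sobolev s)}"

end

theory Submission
  imports Defs
begin

text \<open>
  The symbol of the wave operator vanishes on the light cone, so \<open>u\<close> and \<open>P u\<close> are of comparable
  size for a wave packet \<open>u\<close> of frequency \<open>R\<close> in a null direction \<open>(1, -b)\<close>, if it has length \<open>R\<close>
  along the other null direction \<open>(1, b)\<close> and width \<open>1\<close> otherwise. Normalised in \<open>L\<^sup>2\<close>, such a packet has
  amplitude \<open>R\<^sup>-\<^sup>1\<^sup>/\<^sup>2\<close>, so near the origin its \<open>H\<^sup>s\<close> norm is about \<open>R\<^sup>s\<^sup>-\<^sup>1\<^sup>/\<^sup>2\<close>, which is unbounded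
  if \<open>s > 1/2\<close>. A sum of packets at lacunary frequencies \<open>R\<^sub>j = M\<^sup>j\<close> with weights \<open>4\<^sup>-\<^sup>j\<close> still lies in the
  domain of \<open>P\<close>, because \<open>P = P\<^sup>*\<close> is closed. Pairing it with a bump in frequency space at \<open>R\<^sub>k\<close> isolates
  the packet number \<open>k\<close>, as the others contribute \<open>O(1 / \<bar>R\<^sub>j - R\<^sub>k\<bar>)\<close> each; this contradicts membership in
  \<open>H\<^sup>s\<close> locally as \<open>k\<close> tends to infinity.
\<close>

section \<open>Elementary smooth functions\<close>

definition flat :: "real poly \<Rightarrow> real \<Rightarrow> real" where
  "flat p x = (if x > 0 then poly p (1 / x) * exp (- (1 / x)) else 0)"

text \<open>For y = 1 / x the chain rule reads d/dx = - y^2 d/dy, which sends p(y) exp(- y) to y^2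
  (p - p')(y) exp(- y). Carrying the polynomial along makes the family of all \<open>flat p\<close>
  closed under differentiation.\<close>

definition flat_deriv :: "real poly \<Rightarrow> real poly" where
  "flat_deriv p = pCons 0 (pCons 0 (p - pderiv p))"

lemma poly_mult_exp_minus_tendsto_0:
  "((\<lambda>y. poly p y * exp (- y)) \<longlongrightarrow> (0::real)) at_top"
proof -
  have "((\<lambda>y. \<Sum>i\<le>degree p. coeff p i * (y ^ i / exp y)) \<longlongrightarrow> (\<Sum>i\<le>degree p. coeff p i * 0)) at_top"
    by (intro tendsto_intros tendsto_power_div_exp_0)
  moreover have "(\<lambda>y. \<Sum>i\<le>degree p. coeff p i * (y ^ i / exp y)) = (\<lambda>y. poly p y * exp (- y))"
    by (simp add: poly_altdef sum_distrib_right exp_minus divide_inverse mult.assoc)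
  ultimately show ?thesis by simp
qed

lemma flat_has_derivative_at_0: "(flat p has_real_derivative 0) (at 0)"
proof -
  \<comment> \<open>Dividing \<open>flat p x\<close> by x multiplies the polynomial in 1 / x by its
    variable, hence \<open>pCons 0 p\<close>.\<close>
  have "((\<lambda>x. poly (pCons 0 p) (1 / x) * exp (- (1 / x))) \<longlongrightarrow> 0) (at_right (0::real))"
    using filterlim_compose[OF poly_mult_exp_minus_tendsto_0[of "pCons 0 p"] filterlim_inverse_at_top_right]
    by (simp add: inverse_eq_divide)
  then have "((\<lambda>x. (flat p x - flat p 0) / (x - 0)) \<longlongrightarrow> 0) (at_right 0)"
    by (rule Lim_transform_eventually)
      (auto simp: flat_def eventually_at_right_less intro!: eventually_mono[OF eventually_at_right_less])
  moreover have "((\<lambda>x. (flat p x - flat p 0) / (x - 0)) \<longlongrightarrow> 0) (at_left 0)"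
    by (rule Lim_transform_eventually[OF tendsto_const])
      (auto simp: flat_def eventually_at_left_field intro!: exI[of _ "-1"])
  ultimately show ?thesis
    unfolding has_field_derivative_iff by (metis filterlim_at_split)
qed

lemma flat_has_derivative: "(flat p has_real_derivative flat (flat_deriv p) x) (at x)"
proof -
  consider "x > 0" | "x = 0" | "x < 0" by linarith
  then show ?thesis
  proof cases
    case 1
    have "((\<lambda>x. poly p (1 / x) * exp (- (1 / x))) has_real_derivative flat (flat_deriv p) x) (at x)"
    proof -
      have "((\<lambda>x. 1 / x) has_real_derivative - (1 / x * (1 / x))) (at x)"
        using DERIV_inverse[of x] 1 by (simp add: divide_inverse power2_eq_square numeral_2_eq_2)
      then have "((\<lambda>x. poly p (1 / x) * exp (- (1 / x))) has_real_derivative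
          poly p (1 / x) * (exp (- (1 / x)) * - (- (1 / x * (1 / x)))) +
          poly (pderiv p) (1 / x) * (- (1 / x * (1 / x))) * exp (- (1 / x))) (at x)"
        by (intro DERIV_mult' DERIV_chain2[OF poly_DERIV] DERIV_chain2[OF DERIV_exp] DERIV_minus)
      then show ?thesis
        by (rule DERIV_cong) (use 1 in \<open>simp add: flat_def flat_deriv_def algebra_simps\<close>)
    qed
    then show ?thesis
      by (rule has_field_derivative_transform_within_open[where S = "{0<..}"])
        (use 1 in \<open>auto simp: flat_def\<close>)
  next
    case 2
    then show ?thesis using flat_has_derivative_at_0[of p] by (simp add: flat_def)
  next
    case 3
    have "((\<lambda>x. 0) has_real_derivative flat (flat_deriv p) x) (at x)"
      using 3 by (simp add: flat_def)
    then show ?thesis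
      by (rule has_field_derivative_transform_within_open[where S = "{..<0}"])
        (use 3 in \<open>auto simp: flat_def\<close>)
  qed
qed

lemma continuous_on_flat: "continuous_on A (flat p)"
  by (meson DERIV_isCont continuous_at_imp_continuous_on flat_has_derivative)

lemma flat_bounded: "\<exists>B\<ge>0. \<forall>x\<le>1. \<bar>flat p x\<bar> \<le> B"
proof -
  have "bounded (flat p ` {0..1})"
    by (intro compact_imp_bounded compact_continuous_image continuous_on_flat) simp
  then obtain B where B: "\<And>x. x \<in> {0..1} \<Longrightarrow> \<bar>flat p x\<bar> \<le> B" "B > 0"
    unfolding bounded_pos by fastforce
  have "\<bar>flat p x\<bar> \<le> B" if "x \<le> 1" for x
    using B that by (cases "x \<ge> 0") (auto simp: flat_def)
  then show ?thesis using B(2) by (intro exI[of _ B]) auto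
qed

lemma flat_nonpos [simp]: "x \<le> 0 \<Longrightarrow> flat p x = 0"
  by (simp add: flat_def)

lemma flat_1_nonneg: "flat 1 x \<ge> 0"
  by (simp add: flat_def)

lemma flat_1_pos: "x > 0 \<Longrightarrow> flat 1 x > 0"
  by (simp add: flat_def)

lemma flat_1_mono: "x \<le> y \<Longrightarrow> flat 1 x \<le> flat 1 y"
  by (auto simp: flat_def field_simps)

text \<open>One family of quadratic functions covers both cutoffs: \<open>quad 1 0 c e\<close>,
  weakened along \<open>e\<close>, gives the envelope of a packet, and \<open>quad 4 z 0 0\<close>,
  a multiple of the squared distance to \<open>z\<close>, gives a bump.\<close>

definition quad :: "real \<Rightarrow> 'a::euclidean_space \<Rightarrow> real \<Rightarrow> 'a \<Rightarrow> 'a \<Rightarrow> real" where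
  "quad a z c e x = a * ((x - z) \<bullet> (x - z)) - c * (x \<bullet> e)\<^sup>2"

definition quad_grad :: "real \<Rightarrow> 'a::euclidean_space \<Rightarrow> real \<Rightarrow> 'a \<Rightarrow> 'a \<Rightarrow> 'a" where
  "quad_grad a z c e x = (2 * a) *\<^sub>R (x - z) - (2 * c * (x \<bullet> e)) *\<^sub>R e"

lemma quad_has_derivative: "(quad a z c e has_derivative (\<lambda>v. quad_grad a z c e x \<bullet> v)) (at x)"
proof -
  have d: "((\<lambda>x. x - z) has_derivative (\<lambda>v. v - 0)) (at x)" "((\<lambda>x. x \<bullet> e) has_derivative (\<lambda>v. v \<bullet> e)) (at x)"
    by (intro derivative_intros)+
  have "(quad a z c e has_derivative (\<lambda>v. a * ((x - z) \<bullet> (v - 0) + (v - 0) \<bullet> (x - z))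
      - c * ((x \<bullet> e) * (v \<bullet> e) + (v \<bullet> e) * (x \<bullet> e)))) (at x)"
    unfolding quad_def [abs_def] power2_eq_square
    by (intro has_derivative_diff has_derivative_mult_right has_derivative_inner has_derivative_mult d)
  moreover have "(\<lambda>v. a * ((x - z) \<bullet> (v - 0) + (v - 0) \<bullet> (x - z))
      - c * ((x \<bullet> e) * (v \<bullet> e) + (v \<bullet> e) * (x \<bullet> e))) = (\<lambda>v. quad_grad a z c e x \<bullet> v)"
    by (simp add: quad_grad_def inner_diff_left inner_commute algebra_simps)
  ultimately show ?thesis by simp
qed

lemma flat_quad_has_derivative:
  "((\<lambda>x. flat p (1 - quad a z c e x)) has_derivative
     (\<lambda>v. - flat (flat_deriv p) (1 - quad a z c e x) * (quad_grad a z c e x \<bullet> v))) (at x)"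
proof -
  have "((\<lambda>x. 1 - quad a z c e x) has_derivative (\<lambda>v. - (quad_grad a z c e x \<bullet> v))) (at x)"
    by (auto intro!: derivative_eq_intros quad_has_derivative)
  from has_derivative_compose[OF this flat_has_derivative[unfolded has_field_derivative_def]]
  show ?thesis by (simp add: mult.commute)
qed

text \<open>The packets and bumps are built from these generators. The class is closed under
  directional derivatives, because \<open>flat\<close> admits every polynomial and
  \<open>linear\<close> supplies the affine gradients of \<open>quad\<close>; smoothness then
  follows by induction.\<close>

inductive elementary :: "('a::euclidean_space \<Rightarrow> complex) \<Rightarrow> bool" where
  const: "elementary (\<lambda>x. k)"
| linear: "elementary (\<lambda>x. of_real (x \<bullet> v))"
| exp: "elementary (\<lambda>x. exp (\<i> * of_real (x \<bullet> v)))"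
| flat: "elementary (\<lambda>x. of_real (flat p (1 - quad a z c e x)))"
| add: "elementary f \<Longrightarrow> elementary g \<Longrightarrow> elementary (\<lambda>x. f x + g x)"
| mult: "elementary f \<Longrightarrow> elementary g \<Longrightarrow> elementary (\<lambda>x. f x * g x)"

lemma elementary_quad_grad: "elementary (\<lambda>x. of_real (quad_grad a z c e x \<bullet> v))"
proof -
  have "elementary (\<lambda>x. (of_real (2 * a) * of_real (x \<bullet> v) + - of_real (2 * a * (z \<bullet> v)))
      + of_real (- 2 * c * (e \<bullet> v)) * of_real (x \<bullet> e))"
    by (intro elementary.intros)
  then show ?thesis by (simp add: quad_grad_def algebra_simps)
qed

lemma has_derivative_of_real_comp:
  "(f has_derivative f') F \<Longrightarrow> ((\<lambda>x. complex_of_real (f x)) has_derivative (\<lambda>v. of_real (f' v))) F"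
  by (rule bounded_linear.has_derivative[OF bounded_linear_of_real])

lemma exp_inner_has_derivative:
  "((\<lambda>x. exp (\<i> * of_real (x \<bullet> w))) has_derivative
     (\<lambda>v. exp (\<i> * of_real (x \<bullet> w)) * (\<i> * of_real (v \<bullet> w)))) (at x)"
proof -
  have "((\<lambda>x. \<i> * of_real (x \<bullet> w)) has_derivative (\<lambda>v. \<i> * of_real (v \<bullet> w))) (at x)"
    by (intro has_derivative_mult_right has_derivative_of_real_comp has_derivative_inner_left has_derivative_ident)
  from has_derivative_compose[OF this DERIV_exp[unfolded has_field_derivative_def]]
  show ?thesis by simp
qed

lemma elementary_has_derivative:
  assumes "elementary f"
  shows "\<exists>f'. (\<forall>x. (f has_derivative f' x) (at x)) \<and> (\<forall>v. elementary (\<lambda>x. f' x v))"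
  using assms
proof induction
  case (const k)
  show ?case by (intro exI[of _ "\<lambda>x v. 0"]) (auto intro: elementary.intros)
next
  case (linear w)
  show ?case
    by (intro exI[of _ "\<lambda>x v. of_real (v \<bullet> w)"])
      (auto intro!: elementary.intros has_derivative_of_real_comp has_derivative_inner_left)
next
  case (exp w)
  show ?case
    by (intro exI[of _ "\<lambda>x v. exp (\<i> * of_real (x \<bullet> w)) * (\<i> * of_real (v \<bullet> w))"] conjI allI
        exp_inner_has_derivative elementary.intros)
next
  case (flat p a z c e)
  have "elementary (\<lambda>x. (-1) * of_real (flat (flat_deriv p) (1 - quad a z c e x)) * of_real (quad_grad a z c e x \<bullet> v))" for v
    by (intro elementary.intros elementary_quad_grad)
  then have "elementary (\<lambda>x. complex_of_real (- flat (flat_deriv p) (1 - quad a z c e x) * (quad_grad a z c e x \<bullet> v)))" for v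
    by simp
  then show ?case
    by (intro exI[of _ "\<lambda>x v. of_real (- flat (flat_deriv p) (1 - quad a z c e x) * (quad_grad a z c e x \<bullet> v))"]
        conjI allI has_derivative_of_real_comp flat_quad_has_derivative)
next
  case (add f g)
  then obtain f' g' where "\<forall>x. (f has_derivative f' x) (at x)" "\<forall>v. elementary (\<lambda>x. f' x v)"
    "\<forall>x. (g has_derivative g' x) (at x)" "\<forall>v. elementary (\<lambda>x. g' x v)"
    by blast
  then show ?case
    by (intro exI[of _ "\<lambda>x v. f' x v + g' x v"]) (auto intro!: elementary.intros has_derivative_add)
next
  case (mult f g)
  then obtain f' g' where "\<forall>x. (f has_derivative f' x) (at x)" "\<forall>v. elementary (\<lambda>x. f' x v)"
    "\<forall>x. (g has_derivative g' x) (at x)" "\<forall>v. elementary (\<lambda>x. g' x v)"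
    by blast
  then show ?case using mult.hyps
    by (intro exI[of _ "\<lambda>x v. f x * g' x v + f' x v * g x"])
      (auto intro!: elementary.intros has_derivative_mult)
qed

lemma elementary_iter_pd: "elementary f \<Longrightarrow> elementary (iter_pd bs f)"
proof (induction bs)
  case (Cons b bs)
  then obtain f' where "\<forall>x. (iter_pd bs f has_derivative f' x) (at x)" "elementary (\<lambda>x. f' x b)"
    using elementary_has_derivative by blast
  moreover from this have "frechet_derivative (iter_pd bs f) (at x) = f' x" for x
    using frechet_derivative_at by metis
  ultimately show ?case by simp
qed simp

section \<open>Smoothness, test functions and Schwartz functions\<close>

lemma elementary_smooth: "elementary f \<Longrightarrow> smooth f"
  unfolding smooth_def differentiable_def
  using elementary_has_derivative elementary_iter_pd by metis

lemma elementary_continuous: "elementary f \<Longrightarrow> continuous_on A f"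
  using elementary_has_derivative has_derivative_continuous continuous_at_imp_continuous_on by metis

lemma elementary_borel: "elementary f \<Longrightarrow> f \<in> borel_measurable borel"
  by (rule borel_measurable_continuous_onI[OF elementary_continuous])

lemma elementary_test_functionI:
  assumes "elementary f" "\<And>x. f x \<noteq> 0 \<Longrightarrow> norm x \<le> r"
  shows "f \<in> test_functions"
proof -
  have "bounded {x. f x \<noteq> 0}"
    using assms(2) unfolding bounded_iff by blast
  then show ?thesis
    using elementary_smooth[OF assms(1)] by (auto simp: test_functions_def bounded_closure compact_eq_bounded_closed)
qed

lemma iter_pd_eq_0_outside_support:
  assumes "x \<notin> closure {x. f x \<noteq> 0}"
  shows "iter_pd bs f x = 0"
  using assms
proof (induction bs arbitrary: x)
  case Nil
  then show ?case using closure_subset[of "{x. f x \<noteq> 0}"] by auto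
next
  case (Cons b bs)
  have "(iter_pd bs f has_derivative (\<lambda>v. 0)) (at x)"
    by (rule has_derivative_transform_within_open[where f = "\<lambda>x. 0" and s = "- closure {x. f x \<noteq> 0}"])
      (use Cons in auto)
  then have "frechet_derivative (iter_pd bs f) (at x) = (\<lambda>v. 0)"
    using frechet_derivative_at by metis
  then show ?case by simp
qed

lemma test_function_imp_schwartz: 
  assumes "f \<in> test_functions"
  shows "f \<in> schwartz_functions"
proof -
  define K where "K = closure {x. f x \<noteq> 0}"
  have K: "compact K" "smooth f"
    using assms by (auto simp: test_functions_def K_def)
  have "bounded (range (\<lambda>x. of_real ((1 + norm x) ^ k) * iter_pd bs f x))" if "bs \<in> lists Basis" for bs k
  proof -
    have "continuous_on K (iter_pd bs f)"
      using K(2) that unfolding smooth_def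
      by (intro continuous_at_imp_continuous_on ballI differentiable_imp_continuous_within) auto
    then have "bounded ((\<lambda>x. of_real ((1 + norm x) ^ k) * iter_pd bs f x) ` K)"
      by (intro compact_imp_bounded compact_continuous_image K continuous_intros)
    then have "bounded (insert 0 ((\<lambda>x. of_real ((1 + norm x) ^ k) * iter_pd bs f x) ` K))"
      by simp
    then show ?thesis
    proof (rule bounded_subset, intro image_subsetI)
      fix x
      show "of_real ((1 + norm x) ^ k) * iter_pd bs f x \<in>
          insert 0 ((\<lambda>x. of_real ((1 + norm x) ^ k) * iter_pd bs f x) ` K)"
        using iter_pd_eq_0_outside_support[of x f bs] by (cases "x \<in> K") (simp_all add: K_def)
    qed
  qed
  then show ?thesis using K by (auto simp: schwartz_functions_def)
qed

section \<open>Square-integrable functions\<close>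

lemma integrable_dominated:
  fixes f :: "'a::euclidean_space \<Rightarrow> 'b::{banach, second_countable_topology}"
  assumes "integrable lborel g" "f \<in> borel_measurable borel" "\<And>x. norm (f x) \<le> g x"
  shows "integrable lborel f"
proof (rule Bochner_Integration.integrable_bound[OF assms(1)])
  show "AE x in lborel. norm (f x) \<le> norm (g x)"
    by (intro always_eventually allI order_trans[OF assms(3)]) simp
qed (use assms(2) in simp)

lemma L2_borel: "f \<in> L2 \<Longrightarrow> f \<in> borel_measurable borel"
  and L2_integrable: "f \<in> L2 \<Longrightarrow> integrable lborel (\<lambda>x. (cmod (f x))\<^sup>2)"
  by (auto simp: L2_def)

lemma L2_cnj: "f \<in> L2 \<Longrightarrow> (\<lambda>x. cnj (f x)) \<in> L2"
  by (auto simp: L2_def intro: borel_measurable_continuous_on[where f = cnj] continuous_on_cnj continuous_on_id)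

lemma L2_diff_scaled:
  assumes "f \<in> L2" "g \<in> L2"
  shows "(\<lambda>x. f x - k * g x) \<in> L2"
proof -
  have [measurable]: "f \<in> borel_measurable borel" "g \<in> borel_measurable borel"
    using assms L2_borel by auto
  have "(cmod (f x - k * g x))\<^sup>2 \<le> 2 * (cmod (f x))\<^sup>2 + 2 * (cmod k)\<^sup>2 * (cmod (g x))\<^sup>2" for x
  proof -
    have "cmod (f x - k * g x) \<le> cmod (f x) + cmod k * cmod (g x)"
      by (metis norm_mult norm_triangle_ineq4)
    then have "(cmod (f x - k * g x))\<^sup>2 \<le> (cmod (f x) + cmod k * cmod (g x))\<^sup>2"
      by (intro power_mono) auto
    also have "\<dots> \<le> 2 * (cmod (f x))\<^sup>2 + 2 * (cmod k)\<^sup>2 * (cmod (g x))\<^sup>2"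
      using zero_le_power2[of "cmod (f x) - cmod k * cmod (g x)"]
      by (simp add: power2_diff power2_sum power_mult_distrib)
    finally show ?thesis .
  qed
  note le = this
  have "integrable lborel (\<lambda>x. (cmod (f x - k * g x))\<^sup>2)"
    by (rule integrable_dominated[where g = "\<lambda>x. 2 * (cmod (f x))\<^sup>2 + 2 * (cmod k)\<^sup>2 * (cmod (g x))\<^sup>2"])
      (use assms[THEN L2_integrable] le in simp_all)
  then show ?thesis by (simp add: L2_def)
qed

text \<open>Later uses only ask for a bound in terms of the two squared norms, so the
  arithmetic-geometric mean inequality can take the place of Cauchy-Schwarz.\<close>

lemma L2_mult:
  assumes "f \<in> L2" "g \<in> L2"
  shows "integrable lborel (\<lambda>x. f x * g x)" (is ?A)
    and "(LINT x|lborel. cmod (f x * g x)) \<le>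
      ((LINT x|lborel. (cmod (f x))\<^sup>2) + (LINT x|lborel. (cmod (g x))\<^sup>2)) / 2" (is ?B)
proof -
  have [measurable]: "f \<in> borel_measurable borel" "g \<in> borel_measurable borel"
    using assms L2_borel by auto
  note [simp] = assms[THEN L2_integrable]
  have le: "cmod (f x * g x) \<le> ((cmod (f x))\<^sup>2 + (cmod (g x))\<^sup>2) / 2" for x
    using zero_le_power2[of "cmod (f x) - cmod (g x)"] by (simp add: power2_diff norm_mult)
  have int: "integrable lborel (\<lambda>x. ((cmod (f x))\<^sup>2 + (cmod (g x))\<^sup>2) / 2)"
    by simp
  show A: ?A
    by (rule integrable_dominated[OF int]) (use le in simp_all)
  have "(LINT x|lborel. cmod (f x * g x)) \<le> (LINT x|lborel. ((cmod (f x))\<^sup>2 + (cmod (g x))\<^sup>2) / 2)"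
    by (intro integral_mono integrable_norm A int le)
  then show ?B by simp
qed

lemma bounded_finite_support_integrable:
  fixes f :: "'a::euclidean_space \<Rightarrow> complex"
  assumes "f \<in> borel_measurable borel" "\<And>x. x \<notin> A \<Longrightarrow> f x = 0" "\<And>x. cmod (f x) \<le> B"
    and A: "A \<in> sets borel" "emeasure lborel A < \<infinity>"
  shows "integrable lborel f" "f \<in> L2"
    "(LINT x|lborel. (cmod (f x))\<^sup>2) \<le> B\<^sup>2 * measure lborel A"
proof -
  note [measurable] = assms(1) A(1)
  show "integrable lborel f"
    by (rule integrableI_bounded_set[of A _ _ B]) (use assms in auto)
  have sq: "(cmod (f x))\<^sup>2 \<le> B\<^sup>2" for x
    by (intro power_mono assms) auto
  have int: "integrable lborel (\<lambda>x. (cmod (f x))\<^sup>2)"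
    by (rule integrableI_bounded_set[of A _ _ "B\<^sup>2"]) (use assms sq in auto)
  then show "f \<in> L2" by (simp add: L2_def)
  have "(LINT x|lborel. (cmod (f x))\<^sup>2) \<le> (LINT x|lborel. B\<^sup>2 * indicator A x)"
    using A by (intro integral_mono int) (use assms(2) sq in \<open>auto split: split_indicator\<close>)
  also have "\<dots> = B\<^sup>2 * measure lborel A"
    by simp
  finally show "(LINT x|lborel. (cmod (f x))\<^sup>2) \<le> B\<^sup>2 * measure lborel A" .
qed

section \<open>Weighted series in \<open>L2\<close> and closedness of self-adjoint relations\<close>

lemma quarter_powers: "summable (\<lambda>j. (1/4) ^ j :: real)" "(\<Sum>j<n. (1/4) ^ j) \<le> (2::real)"
proof -
  show s: "summable (\<lambda>j. (1/4) ^ j :: real)" by (rule summable_geometric) simp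
  have "(\<Sum>j<n. (1/4) ^ j) \<le> (\<Sum>j. (1/4) ^ j :: real)"
    by (rule sum_le_suminf[OF s]) auto
  also have "\<dots> \<le> 2" by (simp add: suminf_geometric)
  finally show "(\<Sum>j<n. (1/4) ^ j) \<le> (2::real)" .
qed

text \<open>The bound \<open>B\<close> makes the series converge at every point, the bound
  \<open>C\<close> makes the sum \<open>G\<close> of (1/4)^j |v_j|^2 integrable, and Cauchy-Schwarz
  against the weights dominates |U|^2 by 2 G. Inner products may be taken term by term because the
  integrals of |f v_j| are bounded in j.\<close>

lemma L2_series:
  fixes v :: "nat \<Rightarrow> 'a::euclidean_space \<Rightarrow> complex"
  assumes L2: "\<And>j. v j \<in> L2"
    and C: "\<And>j. (LINT x|lborel. (cmod (v j x))\<^sup>2) \<le> C"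
    and B: "\<And>j x. cmod (v j x) \<le> B"
  defines "U \<equiv> \<lambda>x. \<Sum>j. (1/4) ^ j * v j x"
  shows "U \<in> L2"
    and "\<And>f. f \<in> L2 \<Longrightarrow> (\<lambda>j. (1/4) ^ j * L2_inner f (v j)) sums L2_inner f U"
proof -
  have [measurable]: "v j \<in> borel_measurable borel" for j
    using L2 L2_borel by auto
  have summ: "summable (\<lambda>j. (1/4) ^ j * c j)" if "\<And>j. \<bar>c j\<bar> \<le> K" for c :: "nat \<Rightarrow> real" and K
  proof (rule summable_comparison_test'[OF summable_mult[OF quarter_powers(1), of K], of 0])
    show "norm ((1/4) ^ j * c j) \<le> K * (1/4) ^ j" for j
      using that[of j] by (simp add: abs_mult)
  qed
  have norm_summ: "summable (\<lambda>j. norm ((1/4) ^ j * v j x))" for x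
    using summ[of "\<lambda>j. cmod (v j x)" B] B by (simp add: norm_mult norm_power norm_divide)
  have sq_B: "(cmod (v j x))\<^sup>2 \<le> B\<^sup>2" for j x
    by (intro power_mono B) auto
  define G where "G = (\<lambda>x. \<Sum>j. (1/4) ^ j * (cmod (v j x))\<^sup>2)"
  have int_G: "integrable lborel G"
    unfolding G_def
  proof (rule integrable_suminf)
    show "AE x in lborel. summable (\<lambda>j. norm ((1/4) ^ j * (cmod (v j x))\<^sup>2))"
      using summ[of "\<lambda>j. (cmod (v j x))\<^sup>2" "B\<^sup>2" for x] sq_B by (simp add: abs_mult)
    show "summable (\<lambda>j. LINT x|lborel. norm ((1/4) ^ j * (cmod (v j x))\<^sup>2))"
      using summ[of "\<lambda>j. LINT x|lborel. (cmod (v j x))\<^sup>2" C] C by (simp add: abs_mult)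
  qed (use L2[THEN L2_integrable] in simp)
  have quarter: "((1/2) ^ j)\<^sup>2 = (1/4 :: real) ^ j" for j
  proof -
    have "((1/2) ^ j)\<^sup>2 = ((1/2)\<^sup>2 :: real) ^ j"
      by (metis power_mult mult.commute)
    then show ?thesis by (simp add: power2_eq_square)
  qed
  have U_bound: "cmod (U x) \<le> sqrt (2 * G x)" for x
  proof -
    have "cmod (\<Sum>j<n. (1/4) ^ j * v j x) \<le> sqrt (2 * G x)" for n
    proof (rule real_le_rsqrt)
      \<comment> \<open>Splitting the weight into two factors (1/2)^j prepares Cauchy-Schwarz, whose
        squares restore (1/4)^j in both sums.\<close>
      have "cmod (\<Sum>j<n. (1/4) ^ j * v j x) \<le> (\<Sum>j<n. (1/2) ^ j * ((1/2) ^ j * cmod (v j x)))"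
        by (rule order_trans[OF norm_sum])
          (simp add: norm_mult norm_power norm_divide mult.assoc[symmetric] power_mult_distrib[symmetric])
      then have "(cmod (\<Sum>j<n. (1/4) ^ j * v j x))\<^sup>2 \<le> (\<Sum>j<n. (1/2) ^ j * ((1/2) ^ j * cmod (v j x)))\<^sup>2"
        by (intro power_mono) auto
      also have "\<dots> \<le> (\<Sum>j<n. ((1/2) ^ j)\<^sup>2) * (\<Sum>j<n. ((1/2) ^ j * cmod (v j x))\<^sup>2)"
        by (rule Cauchy_Schwarz_ineq_sum)
      also have "\<dots> = (\<Sum>j<n. (1/4) ^ j) * (\<Sum>j<n. (1/4) ^ j * (cmod (v j x))\<^sup>2)"
        by (simp only: power_mult_distrib quarter)
      also have "\<dots> \<le> 2 * G x"
        unfolding G_def using sq_B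
        by (intro mult_mono quarter_powers sum_le_suminf summ[of _ "B\<^sup>2"] sum_nonneg) auto
      finally show "(cmod (\<Sum>j<n. (1/4) ^ j * v j x))\<^sup>2 \<le> 2 * G x" .
    qed
    moreover have "(\<lambda>n. cmod (\<Sum>j<n. (1/4) ^ j * v j x)) \<longlonglongrightarrow> cmod (U x)"
      unfolding U_def
      by (intro tendsto_norm summable_LIMSEQ summable_norm_cancel[OF norm_summ])
    ultimately show ?thesis
      by (intro LIMSEQ_le_const2) auto
  qed
  have [measurable]: "U \<in> borel_measurable borel"
    unfolding U_def by measurable
  have U_le: "(cmod (U x))\<^sup>2 \<le> 2 * G x" for x
  proof -
    have "G x \<ge> 0"
      unfolding G_def using sq_B by (intro suminf_nonneg summ[of _ "B\<^sup>2"]) auto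
    then show ?thesis
      using power_mono[OF U_bound[of x], of 2] by simp
  qed
  have "integrable lborel (\<lambda>x. (cmod (U x))\<^sup>2)"
    by (rule integrable_dominated[where g = "\<lambda>x. 2 * G x"]) (use int_G U_le in simp_all)
  then show "U \<in> L2" by (simp add: L2_def)
  fix f :: "'a \<Rightarrow> complex"
  assume f: "f \<in> L2"
  have [measurable]: "f \<in> borel_measurable borel"
    using f L2_borel by auto
  let ?g = "\<lambda>j x. f x * cnj ((1/4) ^ j * v j x)"
  have cn: "?g j x = (1/4) ^ j * (f x * cnj (v j x))" for j x
    by simp
  have int: "integrable lborel (?g j)" for j
    unfolding cn by (intro integrable_mult_right L2_mult f L2_cnj L2)
  have "(\<lambda>j. integral\<^sup>L lborel (?g j)) sums (LINT x|lborel. (\<Sum>j. ?g j x))"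
  proof (rule sums_integral[OF int])
    show "AE x in lborel. summable (\<lambda>j. norm (?g j x))"
      using summable_mult[OF norm_summ] by (simp only: norm_mult complex_mod_cnj) simp
    let ?K = "((LINT x|lborel. (cmod (f x))\<^sup>2) + C) / 2"
    have "(LINT x|lborel. cmod (f x * cnj (v j x))) \<le> ?K" for j
      using L2_mult(2)[OF f L2_cnj[OF L2[of j]]] C[of j] by simp
    then have "summable (\<lambda>j. (1/4) ^ j * (LINT x|lborel. cmod (f x * cnj (v j x))))"
      by (intro summ[of _ ?K]) auto
    then show "summable (\<lambda>j. LINT x|lborel. norm (?g j x))"
      unfolding cn norm_mult[of "(1/4) ^ _"] by (simp add: norm_power norm_divide)
  qed
  moreover have "(\<Sum>j. ?g j x) = f x * cnj (U x)" for x
  proof -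
    have "(\<lambda>j. cnj ((1/4) ^ j * v j x)) sums cnj (U x)"
      unfolding U_def sums_cnj by (intro summable_sums summable_norm_cancel[OF norm_summ])
    then show ?thesis
      using sums_mult sums_unique by metis
  qed
  moreover have "integral\<^sup>L lborel (?g j) = (1/4) ^ j * L2_inner f (v j)" for j
    unfolding cn L2_inner_def by simp
  ultimately show "(\<lambda>j. (1/4) ^ j * L2_inner f (v j)) sums L2_inner f U"
    by (simp add: L2_inner_def)
qed

lemma L2_mult_left: "f \<in> L2 \<Longrightarrow> (\<lambda>x. k * f x) \<in> L2"
  by (auto simp: L2_def norm_mult power_mult_distrib intro: borel_measurable_times)

text \<open>Distributions pair bilinearly, whereas \<open>L2_inner\<close> conjugates its second
  argument; conjugating \<open>g\<close> and the resulting sums reduces this case to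
  \<open>L2_series\<close>.\<close>

lemma L2_series_bilinear:
  fixes v :: "nat \<Rightarrow> 'a::euclidean_space \<Rightarrow> complex"
  assumes "\<And>j. v j \<in> L2" "\<And>j. (LINT x|lborel. (cmod (v j x))\<^sup>2) \<le> C"
    and "\<And>j x. cmod (v j x) \<le> B" "g \<in> L2"
  shows "(\<lambda>j. (1/4) ^ j * (LINT x|lborel. v j x * g x)) sums
    (LINT x|lborel. (\<Sum>j. (1/4) ^ j * v j x) * g x)"
proof -
  have conj: "L2_inner (\<lambda>x. cnj (g x)) h = cnj (LINT x|lborel. h x * g x)" for h :: "'a \<Rightarrow> complex"
  proof -
    have "L2_inner (\<lambda>x. cnj (g x)) h = (LINT x|lborel. cnj (h x * g x))"
      unfolding L2_inner_def by (intro Bochner_Integration.integral_cong refl) simp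
    then show ?thesis by (simp only: Bochner_Integration.integral_cnj)
  qed
  have "(\<lambda>j. cnj ((1/4) ^ j * (LINT x|lborel. v j x * g x))) sums
    cnj (LINT x|lborel. (\<Sum>j. (1/4) ^ j * v j x) * g x)"
    using L2_series(2)[OF assms(1-3) L2_cnj[OF assms(4)]] by (simp add: conj)
  then show ?thesis by (simp only: sums_cnj)
qed

text \<open>This is the closedness of an adjoint. For each (u, f) in \<open>T\<close> the identity
  that pairs it with (\<phi> j, \<psi> j) can be summed term by term, so the pair of sums lies in
  \<open>op_adjoint T\<close>, which is \<open>T\<close>.\<close>

lemma self_adjoint_series:
  fixes s :: "nat \<Rightarrow> real"
  assumes T: "self_adjoint T" and mem: "\<And>j. (\<phi> j, \<psi> j) \<in> T"
    and \<phi>: "\<And>j. (LINT x|lborel. (cmod (of_real (s j) * \<phi> j x))\<^sup>2) \<le> C"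
      "\<And>j x. cmod (of_real (s j) * \<phi> j x) \<le> B"
    and \<psi>: "\<And>j. (LINT x|lborel. (cmod (of_real (s j) * \<psi> j x))\<^sup>2) \<le> C'"
      "\<And>j x. cmod (of_real (s j) * \<psi> j x) \<le> B'"
  shows "(\<lambda>x. \<Sum>j. (1/4) ^ j * (of_real (s j) * \<phi> j x), \<lambda>x. \<Sum>j. (1/4) ^ j * (of_real (s j) * \<psi> j x)) \<in> T"
    (is "(?U, ?W) \<in> T")
proof -
  have T_L2: "T \<subseteq> L2 \<times> L2" and adj: "op_adjoint T = T"
    using T by (auto simp: self_adjoint_def)
  have L2: "\<phi> j \<in> L2" "\<psi> j \<in> L2" for j
    using mem[of j] T_L2 by auto
  note U = L2_series[where v = "\<lambda>j x. of_real (s j) * \<phi> j x", OF L2_mult_left[OF L2(1)] \<phi>]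
  note W = L2_series[where v = "\<lambda>j x. of_real (s j) * \<psi> j x", OF L2_mult_left[OF L2(2)] \<psi>]
  have scale: "L2_inner f (\<lambda>x. of_real k * g x) = of_real k * L2_inner f g" for f g :: "'a \<Rightarrow> complex" and k
  proof -
    have "L2_inner f (\<lambda>x. of_real k * g x) = (LINT x|lborel. of_real k * (f x * cnj (g x)))"
      by (simp add: L2_inner_def mult_ac)
    also have "\<dots> = of_real k * L2_inner f g"
      unfolding L2_inner_def by (rule integral_mult_right_zero)
    finally show ?thesis .
  qed
  have "L2_inner f ?U = L2_inner u ?W" if "(u, f) \<in> T" for u f
  proof -
    have "u \<in> L2" "f \<in> L2"
      using that T_L2 by auto
    have "L2_inner f (\<phi> j) = L2_inner u (\<psi> j)" for j
    proof -
      have "(\<phi> j, \<psi> j) \<in> op_adjoint T" using mem adj by simp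
      then have "\<forall>(u, f)\<in>T. L2_inner f (\<phi> j) = L2_inner u (\<psi> j)"
        unfolding op_adjoint_def by simp
      then show ?thesis using that by blast
    qed
    then show ?thesis
      using U(2)[OF \<open>f \<in> L2\<close>] W(2)[OF \<open>u \<in> L2\<close>] sums_unique2 by (simp add: scale)
  qed
  then have "(?U, ?W) \<in> op_adjoint T"
    using U(1) W(1) by (auto simp: op_adjoint_def)
  then show ?thesis by (simp add: adj)
qed

section \<open>Translation invariance and oscillatory integrals\<close>

lemma lborel_integral_translate:
  fixes f :: "'a::euclidean_space \<Rightarrow> complex"
  assumes "f \<in> borel_measurable borel"
  shows "(LINT x|lborel. f (c + x)) = (LINT x|lborel. f x)"
  using integral_distr[of "(+) c" lborel borel f] assms by (simp add: lborel_distr_plus)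

lemma lborel_integrable_translate:
  fixes f :: "'a::euclidean_space \<Rightarrow> complex"
  assumes "integrable lborel f"
  shows "integrable lborel (\<lambda>x. f (c + x))"
  using integrable_distr[of "(+) c" lborel borel f] assms by (simp add: lborel_distr_plus)

text \<open>Translating by half a period in the direction \<open>w\<close> flips the sign of the exponential.\<close>

lemma oscillatory_integral_bound:
  fixes F :: "'a::euclidean_space \<Rightarrow> complex"
  assumes int: "integrable lborel F"
    and supp: "\<And>x. norm x > r \<Longrightarrow> F x = 0"
    and lip: "\<And>x y. cmod (F x - F y) \<le> L * norm (x - y)"
    and "w \<noteq> 0" "k \<noteq> 0"
  shows "cmod (LINT x|lborel. exp (\<i> * of_real (k * (x \<bullet> w))) * F x)
    \<le> L * pi / (\<bar>k\<bar> * norm w) * measure lborel (cball (0::'a) r)"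
\<comment> \<open>For negative \<open>r\<close> the support condition forces F = 0; the volume
  formula for balls used at the end applies to nonnegative radii.\<close>
proof (cases "r \<ge> 0")
  case False
  then have "F x = 0" for x
    using supp[of x] norm_ge_zero[of x] by (meson not_le order.strict_trans2)
  then show ?thesis using False by simp
next
  case r: True
  define h where "h = (pi / (k * (norm w)\<^sup>2)) *\<^sub>R w"
  define E where "E = (\<lambda>x. exp (\<i> * of_real (k * (x \<bullet> w))))"
  have F_meas [measurable]: "F \<in> borel_measurable borel"
    using int by (simp add: borel_measurable_integrable)
  have E_meas [measurable]: "E \<in> borel_measurable borel"
    unfolding E_def by measurable
  have norm_h: "norm h = pi / (\<bar>k\<bar> * norm w)"
    using assms by (simp add: h_def abs_mult power2_eq_square)
  have "h \<bullet> w = pi / k"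
    using assms by (simp add: h_def dot_square_norm)
  then have "k * ((h + x) \<bullet> w) = pi + k * (x \<bullet> w)" for x
    using assms by (simp add: inner_add_left field_simps)
  then have E_shift: "E (h + x) = - E x" for x
    by (simp add: E_def distrib_left exp_add mult.commute[of \<i> "of_real pi"] flip: of_real_mult)
  have fin: "emeasure lborel (cball c r) < top" for c :: 'a
    using emeasure_lborel_cball_finite[of c r] by simp
  have norm_E: "cmod (E x) = 1" for x
    by (simp add: E_def)
  have int_EF: "integrable lborel (\<lambda>x. E x * F x)"
    by (rule integrable_dominated[OF integrable_norm[OF int]]) (simp_all add: norm_mult norm_E)
  have int_EF': "integrable lborel (\<lambda>x. E x * F (h + x))"
    using lborel_integrable_translate[OF int_EF, of h] by (simp add: E_shift)
  have "(LINT x|lborel. E x * F x) = (LINT x|lborel. E (h + x) * F (h + x))"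
    by (rule lborel_integral_translate[symmetric]) measurable
  also have "\<dots> = - (LINT x|lborel. E x * F (h + x))"
    by (simp add: E_shift)
  finally have "2 * (LINT x|lborel. E x * F x) = (LINT x|lborel. E x * F x) - (LINT x|lborel. E x * F (h + x))"
    by simp
  also have "\<dots> = (LINT x|lborel. E x * (F x - F (h + x)))"
    using int_EF int_EF' by (simp add: right_diff_distrib)
  finally have "2 * cmod (LINT x|lborel. E x * F x) = cmod (LINT x|lborel. E x * (F x - F (h + x)))"
    by (metis norm_mult norm_numeral)
  \<comment> \<open>The difference vanishes outside the ball and its translate by -h. Their equal
    volumes produce a factor 2, which cancels the one on the left.\<close>
  also have "\<dots> \<le> (LINT x|lborel. L * norm h * (indicator (cball 0 r) x + indicator (cball (- h) r) x))"
  proof (rule Bochner_Integration.integral_norm_bound_integral)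
    show "integrable lborel (\<lambda>x. E x * (F x - F (h + x)))"
      using int_EF int_EF' by (simp add: right_diff_distrib)
    show "integrable lborel (\<lambda>x. L * norm h * (indicator (cball 0 r) x + indicator (cball (- h) r) x))"
      by (intro integrable_mult_right Bochner_Integration.integrable_add integrable_real_indicator)
        (simp_all add: fin)
    fix x
    have "cmod (F x - F (h + x)) \<le> L * norm h"
      using lip[of x "h + x"] by simp
    moreover from this have "0 \<le> L * norm h"
      using norm_ge_zero order_trans by blast
    moreover have "F x - F (h + x) = 0" if "x \<notin> cball 0 r" "x \<notin> cball (- h) r"
      using that supp[of x] supp[of "h + x"] by (simp add: dist_norm norm_minus_commute add.commute)
    ultimately show "norm (E x * (F x - F (h + x)))
        \<le> L * norm h * (indicator (cball 0 r) x + indicator (cball (- h) r) x)"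
      by (auto simp: norm_mult norm_E split: split_indicator)
  qed
  also have "\<dots> = L * norm h * (LINT x|lborel. indicator (cball 0 r) x + indicator (cball (- h) r) x)"
    by (rule integral_mult_right_zero)
  also have "\<dots> = L * norm h * (measure lborel (cball (0::'a) r) + measure lborel (cball (- h) r))"
    by (subst Bochner_Integration.integral_add) (simp_all add: fin)
  also have "\<dots> = 2 * (L * norm h * measure lborel (cball (0::'a) r))"
    using r by (simp add: content_cball)
  finally show ?thesis
    by (simp add: E_def norm_h)
qed

section \<open>Wave packets\<close>

text \<open>
  In the application \<open>e\<close> and \<open>w\<close> are the two null directions \<open>(1, \<plusminus> b)\<close> and \<open>c = (1 - R\<^sup>-\<^sup>2) / 2\<close>:
  \<open>packet 1 R c e w\<close> oscillates with frequency \<open>R\<close> in the direction \<open>w\<close>, and is localised at scale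
  \<open>R\<close> in the direction \<open>e\<close> and at scale \<open>1\<close> in the orthogonal directions.
\<close>

definition packet ::
    "real poly \<Rightarrow> real \<Rightarrow> real \<Rightarrow> 'a::euclidean_space \<Rightarrow> 'a \<Rightarrow> 'a \<Rightarrow> complex" where
  "packet p R c e w x = exp (\<i> * of_real (x \<bullet> (R *\<^sub>R w))) * of_real (flat p (1 - quad 1 0 c e x))"

section \<open>Derivatives of a packet\<close>

lemma packet_elementary: "elementary (packet p R c e w)"
  unfolding packet_def [abs_def] by (intro elementary.intros)

lemma packet_has_derivative:
  "(packet p R c e w has_derivative
     (\<lambda>v. \<i> * of_real (R * (w \<bullet> v)) * packet p R c e w x
        - of_real (quad_grad 1 0 c e x \<bullet> v) * packet (flat_deriv p) R c e w x)) (at x)"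
  unfolding packet_def [abs_def]
  by (rule has_derivative_eq_rhs[OF has_derivative_mult[OF exp_inner_has_derivative
          has_derivative_of_real_comp[OF flat_quad_has_derivative]]])
    (simp add: fun_eq_iff algebra_simps inner_commute)

lemma quad_grad_inner_has_derivative:
  "((\<lambda>x. quad_grad a z c e x \<bullet> v) has_derivative (\<lambda>u. 2 * a * (u \<bullet> v) - 2 * c * (u \<bullet> e) * (e \<bullet> v))) (at x)"
proof -
  have "((\<lambda>x. (2 * a) * ((x \<bullet> v) - z \<bullet> v) - (2 * c * (e \<bullet> v)) * (x \<bullet> e)) has_derivative
     (\<lambda>u. (2 * a) * ((u \<bullet> v) - 0) - (2 * c * (e \<bullet> v)) * (u \<bullet> e))) (at x)"
    by (intro has_derivative_diff has_derivative_mult_right has_derivative_inner_left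
        has_derivative_ident has_derivative_const)
  then show ?thesis
    by (simp add: quad_grad_def inner_diff_left algebra_simps)
qed

text \<open>Here \<open>a\<close> stands for \<open>R * (w \<bullet> v)\<close>, \<open>q\<close>
  and \<open>d\<close> for the first and second derivative of the quadratic form along
  \<open>v\<close>, and \<open>P\<close>, \<open>P1\<close>, \<open>P2\<close> for packets with
  successive \<open>flat_deriv\<close>.\<close>

lemma packet_algebra:
  "\<i> * a * (\<i> * a * P - q * P1) - (q * (\<i> * a * P1 - q * P2) + d * P1) =
    \<i> * \<i> * a * a * P - 2 * \<i> * (a * q) * P1 - d * P1 + q * q * P2"
  by (simp only: ring_distribs) (simp add: algebra_simps)

text \<open>Each derivative falls on the oscillation, at the cost of a factor R, or on the envelope.
  Grouping by powers of R lets the null conditions act on each coefficient separately.\<close>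

lemma packet_second_derivative:
  "iter_pd [v, v] (packet p R c e w) x =
     - of_real (R\<^sup>2 * (w \<bullet> v)\<^sup>2) * packet p R c e w x
     - 2 * \<i> * of_real (R * ((w \<bullet> v) * (quad_grad 1 0 c e x \<bullet> v))) * packet (flat_deriv p) R c e w x
     - of_real (2 * (v \<bullet> v) - 2 * c * (e \<bullet> v)\<^sup>2) * packet (flat_deriv p) R c e w x
     + of_real ((quad_grad 1 0 c e x \<bullet> v)\<^sup>2) * packet (flat_deriv (flat_deriv p)) R c e w x"
proof -
  let ?P = "packet p R c e w" and ?P1 = "packet (flat_deriv p) R c e w"
    and ?q = "\<lambda>x. quad_grad 1 0 c e x \<bullet> v"
  have "frechet_derivative ?P (at x) v = \<i> * of_real (R * (w \<bullet> v)) * ?P x - of_real (?q x) * ?P1 x" for x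
    by (simp only: frechet_derivative_at[OF packet_has_derivative, symmetric])
  then have "iter_pd [v, v] ?P x =
      frechet_derivative (\<lambda>x. \<i> * of_real (R * (w \<bullet> v)) * ?P x - of_real (?q x) * ?P1 x) (at x) v"
    by simp
  also have "\<dots> = \<i> * of_real (R * (w \<bullet> v)) * (\<i> * of_real (R * (w \<bullet> v)) * ?P x - of_real (?q x) * ?P1 x)
       - (of_real (?q x) * (\<i> * of_real (R * (w \<bullet> v)) * ?P1 x - of_real (?q x) * packet (flat_deriv (flat_deriv p)) R c e w x)
          + of_real (2 * 1 * (v \<bullet> v) - 2 * c * (v \<bullet> e) * (e \<bullet> v)) * ?P1 x)"
    by (subst frechet_derivative_at[symmetric], rule has_derivative_diff,
        rule has_derivative_mult_right, rule packet_has_derivative, rule has_derivative_mult,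
        rule has_derivative_of_real_comp, rule quad_grad_inner_has_derivative,
        rule packet_has_derivative, rule refl)
  also have "\<dots> = \<i> * \<i> * of_real (R * (w \<bullet> v)) * of_real (R * (w \<bullet> v)) * ?P x
      - 2 * \<i> * (of_real (R * (w \<bullet> v)) * of_real (?q x)) * ?P1 x
      - of_real (2 * (v \<bullet> v) - 2 * c * (v \<bullet> e) * (e \<bullet> v)) * ?P1 x
      + of_real (?q x) * of_real (?q x) * packet (flat_deriv (flat_deriv p)) R c e w x"
    by (simp only: mult_1_right) (rule packet_algebra)
  finally show ?thesis
    by (simp add: power2_eq_square inner_commute mult_ac)
qed

text \<open>As \<open>e\<close> has length sqrt 2, (x . e)^2 / 2 is the squared length of the
  component of x along \<open>e\<close>. This choice of \<open>c\<close> therefore weights the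
  component along \<open>e\<close> by 1 / R^2 and the orthogonal one by 1. The slope along
  \<open>e\<close> gains the same factor 1 / R^2, while the full gradient stays bounded where
  \<open>quad\<close> is bounded.\<close>

lemma quad_packet_identities:
  assumes e: "e \<bullet> e = 2" and R: "R \<noteq> 0" and c: "c = (1 - 1 / R\<^sup>2) / 2"
  shows "quad 1 0 c e x = (x \<bullet> x - (x \<bullet> e)\<^sup>2 / 2) + (x \<bullet> e)\<^sup>2 / (2 * R\<^sup>2)"
    and "(x \<bullet> e)\<^sup>2 / 2 \<le> x \<bullet> x"
    and "quad_grad 1 0 c e x \<bullet> e = 2 * (x \<bullet> e) / R\<^sup>2"
    and "R\<^sup>2 \<ge> 1 \<Longrightarrow> quad_grad 1 0 c e x \<bullet> quad_grad 1 0 c e x \<le> 4 * quad 1 0 c e x"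
proof -
  show "quad 1 0 c e x = (x \<bullet> x - (x \<bullet> e)\<^sup>2 / 2) + (x \<bullet> e)\<^sup>2 / (2 * R\<^sup>2)"
    using R by (simp add: quad_def c field_simps)
  show "(x \<bullet> e)\<^sup>2 / 2 \<le> x \<bullet> x"
    using Cauchy_Schwarz_ineq[of x e] e by simp
  show "quad_grad 1 0 c e x \<bullet> e = 2 * (x \<bullet> e) / R\<^sup>2"
    using R by (simp add: quad_grad_def inner_diff_left e c field_simps)
  assume "R\<^sup>2 \<ge> 1"
  then have c01: "0 \<le> c" "0 \<le> 1 - 2 * c"
    by (auto simp: c divide_le_eq_1)
  have "quad_grad 1 0 c e x \<bullet> quad_grad 1 0 c e x = 4 * quad 1 0 c e x - 4 * c * (1 - 2 * c) * (x \<bullet> e)\<^sup>2"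
    by (simp add: quad_grad_def quad_def inner_diff_left inner_diff_right e inner_commute power2_eq_square algebra_simps)
  also have "\<dots> \<le> 4 * quad 1 0 c e x"
    using c01 by simp
  finally show "quad_grad 1 0 c e x \<bullet> quad_grad 1 0 c e x \<le> 4 * quad 1 0 c e x" .
qed

lemma quad_packet_lt_1:
  assumes e: "e \<bullet> e = 2" and R: "R \<ge> 1" and c: "c = (1 - 1 / R\<^sup>2) / 2"
    and lt: "quad 1 0 c e x < 1"
  shows "\<bar>x \<bullet> e\<bar> \<le> 2 * R" "x \<bullet> x - (x \<bullet> e)\<^sup>2 / 2 \<le> 1"
proof -
  note id = quad_packet_identities[OF e _ c, of x]
  have "(x \<bullet> e)\<^sup>2 / (2 * R\<^sup>2) \<le> 1"
    using id(1,2) lt R by linarith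
  then have "(x \<bullet> e)\<^sup>2 \<le> 2 * R\<^sup>2"
    using R by (simp add: field_simps)
  also have "\<dots> \<le> (2 * R)\<^sup>2"
    by (simp add: power_mult_distrib)
  finally have "(x \<bullet> e)\<^sup>2 \<le> (2 * R)\<^sup>2" .
  then show "\<bar>x \<bullet> e\<bar> \<le> 2 * R"
    using R power2_le_imp_le[of "\<bar>x \<bullet> e\<bar>" "2 * R"] by simp
  have "(x \<bullet> e)\<^sup>2 / (2 * R\<^sup>2) \<ge> 0" by simp
  then show "x \<bullet> x - (x \<bullet> e)\<^sup>2 / 2 \<le> 1"
    using id(1) lt R by linarith
qed

section \<open>Covering the support of a packet by balls\<close>

definition tube :: "real \<Rightarrow> 'a::euclidean_space \<Rightarrow> 'a set" where
  "tube R e = (\<Union>k\<in>{- (\<lceil>R\<rceil> + 1)..\<lceil>R\<rceil> + 1}. cball (of_int k *\<^sub>R e) 2)"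

text \<open>The component of x along \<open>e\<close> is s e with s = (x . e) / 2. Moving to the
  nearest integer multiple of \<open>e\<close> leaves squared distance at most 1 + 2 (1/2)^2, which
  is below 4, and |s| is at most R. Balls replace a change of coordinates in the estimate of the
  volume.\<close>

lemma quad_packet_lt_1_in_tube:
  assumes e: "e \<bullet> e = 2" and R: "R \<ge> 1" and c: "c = (1 - 1 / R\<^sup>2) / 2"
    and lt: "quad 1 0 c e x < 1"
  shows "x \<in> tube R e"
proof -
  define s where "s = (x \<bullet> e) / 2"
  have xe: "x \<bullet> e = 2 * s" by (simp add: s_def)
  note b = quad_packet_lt_1[OF e R c lt, unfolded xe]
  have rnd: "\<bar>s - of_int (round s)\<bar> \<le> 1/2"
    using of_int_round_abs_le[of s] by (simp add: abs_minus_commute)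
  then have "(s - of_int (round s))\<^sup>2 \<le> (1/2)\<^sup>2"
    by (metis abs_le_square_iff abs_of_nonneg zero_le_divide_1_iff zero_le_numeral)
  moreover have "(norm (x - k *\<^sub>R e))\<^sup>2 = (x \<bullet> x - (2 * s)\<^sup>2 / 2) + 2 * (s - k)\<^sup>2" for k
    by (simp add: power2_norm_eq_inner inner_diff_left inner_diff_right e xe inner_commute[of e x])
      (simp add: power2_eq_square algebra_simps)
  ultimately have "(norm (x - of_int (round s) *\<^sub>R e))\<^sup>2 \<le> 2\<^sup>2"
    using b(2) by (simp add: power2_eq_square)
  then have "x \<in> cball (of_int (round s) *\<^sub>R e) 2"
    using power2_le_imp_le[of "norm (x - of_int (round s) *\<^sub>R e)" 2]
    by (simp add: dist_norm norm_minus_commute)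
  moreover have "round s \<in> {- (\<lceil>R\<rceil> + 1)..\<lceil>R\<rceil> + 1}"
  proof -
    have "\<bar>s\<bar> \<le> R" using b(1) by simp
    then have "\<bar>of_int (round s)\<bar> \<le> real_of_int (\<lceil>R\<rceil> + 1)"
      using rnd le_of_int_ceiling[of R] by linarith
    then have "\<bar>round s\<bar> \<le> \<lceil>R\<rceil> + 1"
      unfolding of_int_abs[symmetric] of_int_le_iff .
    then show ?thesis by auto
  qed
  ultimately show ?thesis unfolding tube_def by blast
qed

lemma tube_measure:
  fixes e :: "'a::euclidean_space"
  assumes "R \<ge> 1"
  shows "tube R e \<in> sets borel" "emeasure lborel (tube R e) < \<infinity>"
    "measure lborel (tube R e) \<le> 7 * R * measure lborel (cball (0::'a) 2)"
proof -
  have cp: "compact (tube R e)"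
    unfolding tube_def by (intro compact_UN) auto
  then show "tube R e \<in> sets borel" by (rule borel_compact)
  show "emeasure lborel (tube R e) < \<infinity>"
    using cp by (rule emeasure_compact_finite)
  let ?K = "{- (\<lceil>R\<rceil> + 1)..\<lceil>R\<rceil> + 1}"
  have "measure lborel (tube R e) \<le> (\<Sum>k\<in>?K. measure lborel (cball (of_int k *\<^sub>R e) 2))"
    unfolding tube_def by (rule measure_UNION_le) auto
  also have "\<dots> = real (card ?K) * measure lborel (cball (0::'a) 2)"
    by (simp add: content_cball)
  \<comment> \<open>There are 2 \<lceil>R\<rceil> + 3 balls, at most 2 R + 5, and 5 is at most 5
    R.\<close>
  also have "real (card ?K) \<le> 7 * R"
    using assms by (simp, linarith)
  finally show "measure lborel (tube R e) \<le> 7 * R * measure lborel (cball (0::'a) 2)"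
    by (simp add: mult_right_mono)
qed

lemma flat_quad_bound:
  assumes B: "\<And>t. t \<le> 1 \<Longrightarrow> \<bar>flat p t\<bar> \<le> B"
    and e: "e \<bullet> e = 2" and R: "R \<ge> 1" and c: "c = (1 - 1 / R\<^sup>2) / 2"
  shows "\<bar>flat p (1 - quad 1 0 c e x)\<bar> \<le> B"
proof (rule B)
  have "(x \<bullet> e)\<^sup>2 / (2 * R\<^sup>2) \<ge> 0" by simp
  then show "1 - quad 1 0 c e x \<le> 1"
    using quad_packet_identities(1,2)[OF e _ c, of x] R by linarith
qed

lemma cmod_packet: "cmod (packet p R c e w x) = \<bar>flat p (1 - quad 1 0 c e x)\<bar>"
  by (simp add: packet_def norm_mult)

lemma packet_eq_0: "quad 1 0 c e x \<ge> 1 \<Longrightarrow> packet p R c e w x = 0"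
  by (simp add: packet_def)

lemma packet_test_function:
  assumes e: "e \<bullet> e = 2" and R: "R \<ge> 1" and c: "c = (1 - 1 / R\<^sup>2) / 2"
  shows "packet p R c e w \<in> test_functions"
proof (rule elementary_test_functionI[OF packet_elementary])
  fix x
  assume "packet p R c e w x \<noteq> 0"
  then have "quad 1 0 c e x < 1"
    using packet_eq_0 by (metis not_le)
  note b = quad_packet_lt_1[OF e R c this]
  have "\<bar>x \<bullet> e\<bar>\<^sup>2 \<le> (2 * R)\<^sup>2"
    by (intro power_mono b) auto
  then have "x \<bullet> x \<le> 1 + (2 * R)\<^sup>2 / 2"
    using b(2) unfolding power2_abs by linarith
  then show "norm x \<le> sqrt (1 + (2 * R)\<^sup>2 / 2)"
    unfolding norm_eq_sqrt_inner by (rule real_sqrt_le_mono)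
qed

section \<open>The wave operator applied to a packet\<close>

lemma wave_combination:
  fixes B :: "'b set" and \<alpha> \<beta> \<gamma> \<delta> :: "'b \<Rightarrow> real" and P P1 P2 :: complex
  shows "(- of_real (r * \<alpha> u) * P - 2 * \<i> * of_real (s * \<beta> u) * P1 - of_real (\<gamma> u) * P1 + of_real (\<delta> u) * P2)
    - (\<Sum>b\<in>A. - of_real (r * \<alpha> (f b)) * P - 2 * \<i> * of_real (s * \<beta> (f b)) * P1
        - of_real (\<gamma> (f b)) * P1 + of_real (\<delta> (f b)) * P2) =
    - of_real (r * (\<alpha> u - (\<Sum>b\<in>A. \<alpha> (f b)))) * P
    - 2 * \<i> * of_real (s * (\<beta> u - (\<Sum>b\<in>A. \<beta> (f b)))) * P1
    - of_real (\<gamma> u - (\<Sum>b\<in>A. \<gamma> (f b))) * P1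
    + of_real (\<delta> u - (\<Sum>b\<in>A. \<delta> (f b))) * P2"
  by (simp add: sum.distrib sum_subtractf sum_negf flip: sum_distrib_left sum_distrib_right)
    (simp add: algebra_simps sum_distrib_left sum_distrib_right)

text \<open>The R^2 term disappears because \<open>w\<close> is null. In the term of order R, the
  Lorentz product of the gradient with \<open>w\<close> is its Euclidean product with
  \<open>e\<close>, which is 2 (x . e) / R^2; only x . e over R survives, and this is bounded on the
  support.\<close>

lemma wave_packet:
  fixes b :: "real^'n"
  assumes b: "b \<in> Basis" and R: "R \<ge> 1" and c: "c = (1 - 1 / R\<^sup>2) / 2"
  defines "e \<equiv> (1, b)" and "w \<equiv> (1, - b)"
  defines "q \<equiv> quad_grad 1 0 c e"
  shows "wave (packet p R c e w) x =
     - 2 * \<i> * of_real (2 * (x \<bullet> e) / R) * packet (flat_deriv p) R c e w x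
     - of_real (2 - 2 * real CARD('n)) * packet (flat_deriv p) R c e w x
     + of_real ((fst (q x))\<^sup>2 - snd (q x) \<bullet> snd (q x)) * packet (flat_deriv (flat_deriv p)) R c e w x"
proof -
  have bb: "b \<bullet> b = 1" using b by simp
  have ee: "e \<bullet> e = 2" using bb by (simp add: e_def)
  have sum_Basis: "(\<Sum>a\<in>Basis. (v \<bullet> a) * (v' \<bullet> a)) = v \<bullet> v'" for v v' :: "real^'n"
    by (rule euclidean_inner[symmetric])
  \<comment> \<open>Trace with respect to the Lorentz form: on a product of two linear forms it
    returns the Lorentz product of their vectors.\<close>
  define W where "W = (\<lambda>g :: real \<times> (real^'n) \<Rightarrow> real. g (1, 0) - (\<Sum>a\<in>Basis. g (0, a)))"
  have W_mult: "W (\<lambda>v. (y \<bullet> v) * (z \<bullet> v)) = fst y * fst z - snd y \<bullet> snd z" for y z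
    by (simp add: W_def inner_prod_def sum_Basis)
  have "W (\<lambda>v. (w \<bullet> v)\<^sup>2) = 0"
    unfolding power2_eq_square W_mult by (simp add: w_def bb)
  moreover have "W (\<lambda>v. (w \<bullet> v) * (q x \<bullet> v)) = 2 * (x \<bullet> e) / R\<^sup>2"
  proof -
    have "W (\<lambda>v. (w \<bullet> v) * (q x \<bullet> v)) = q x \<bullet> e"
      unfolding W_mult by (simp add: w_def e_def inner_prod_def inner_commute)
    then show ?thesis
      unfolding q_def using quad_packet_identities(3)[OF ee _ c, of x] R by simp
  qed
  moreover have "W (\<lambda>v. 2 * (v \<bullet> v) - 2 * c * (e \<bullet> v)\<^sup>2) = 2 - 2 * real CARD('n)"
  proof -
    have "W (\<lambda>v. 2 * (v \<bullet> v) - 2 * c * (e \<bullet> v)\<^sup>2) = 2 * W (\<lambda>v. v \<bullet> v) - 2 * c * W (\<lambda>v. (e \<bullet> v) * (e \<bullet> v))"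
      by (simp add: W_def sum_subtractf sum_distrib_left power2_eq_square algebra_simps)
    also have "\<dots> = 2 - 2 * real CARD('n)"
      unfolding W_mult by (simp add: W_def e_def bb)
    finally show ?thesis .
  qed
  moreover have "W (\<lambda>v. (q x \<bullet> v)\<^sup>2) = (fst (q x))\<^sup>2 - snd (q x) \<bullet> snd (q x)"
    unfolding power2_eq_square W_mult ..
  moreover have "R * (2 * (x \<bullet> e) / R\<^sup>2) = 2 * (x \<bullet> e) / R"
    using R by (simp add: power2_eq_square)
  ultimately show ?thesis
    unfolding wave_def packet_second_derivative q_def[symmetric] W_def
    by (subst wave_combination[where u = "(1, 0)" and f = "\<lambda>a. (0, a)" and \<alpha> = "\<lambda>v. (w \<bullet> v)\<^sup>2"
          and \<beta> = "\<lambda>v. (w \<bullet> v) * (q x \<bullet> v)" and \<gamma> = "\<lambda>v. 2 * (v \<bullet> v) - 2 * c * (e \<bullet> v)\<^sup>2"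
          and \<delta> = "\<lambda>v. (q x \<bullet> v)\<^sup>2"]) (simp only: mult_zero_right of_real_0 mult_zero_left minus_zero diff_0 diff_zero mult_minus_left)
qed

lemma wave_packet_bound:
  obtains C where "\<And>b :: real^'n. \<And>R c x. b \<in> Basis \<Longrightarrow> R \<ge> 1 \<Longrightarrow> c = (1 - 1 / R\<^sup>2) / 2 \<Longrightarrow>
    cmod (wave (packet p R c (1, b) (1, - b)) x) \<le> C"
proof -
  obtain B1 where B1: "B1 \<ge> 0" "\<And>t. t \<le> 1 \<Longrightarrow> \<bar>flat (flat_deriv p) t\<bar> \<le> B1"
    using flat_bounded by blast
  obtain B2 where B2: "B2 \<ge> 0" "\<And>t. t \<le> 1 \<Longrightarrow> \<bar>flat (flat_deriv (flat_deriv p)) t\<bar> \<le> B2"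
    using flat_bounded by blast
  \<comment> \<open>On the support |x . e| is at most 2 R, so 8 bounds
    \<open>2 * (2 * (x \<bullet> e) / R)\<close>. The 4 bounds the Lorentz square of the gradient
    through its Euclidean square; \<open>B1\<close> and \<open>B2\<close> bound the envelopes. None
    of these depends on R.\<close>
  define C where "C = 8 * B1 + (2 + 2 * real CARD('n)) * B1 + 4 * B2"
  have "cmod (wave (packet p R c (1, b) (1, - b)) x) \<le> C"
    if b: "b \<in> Basis" and R: "R \<ge> 1" and c: "c = (1 - 1 / R\<^sup>2) / 2" for b :: "real^'n" and R c x
  proof (cases "quad 1 0 c (1, b) x < 1")
    case False
    then show ?thesis
      unfolding wave_packet[OF that] using B1(1) B2(1) by (simp add: packet_eq_0 C_def)
  next
    case lt: True
    define e where "e = (1 :: real, b)"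
    define q where "q = quad_grad 1 0 c e x"
    have ee: "e \<bullet> e = 2" using b by (simp add: e_def)
    have "R\<^sup>2 \<ge> 1" using R by simp
    then have "q \<bullet> q \<le> 4"
      using quad_packet_identities(4)[OF ee _ c, of x] R lt by (simp add: q_def e_def)
    then have "(fst q)\<^sup>2 + snd q \<bullet> snd q \<le> 4"
      by (simp add: inner_prod_def power2_eq_square)
    then have q: "\<bar>(fst q)\<^sup>2 - snd q \<bullet> snd q\<bar> \<le> 4"
      using zero_le_power2[of "fst q"] inner_ge_zero[of "snd q"] by linarith
    have xe: "\<bar>2 * (2 * (x \<bullet> e) / R)\<bar> \<le> 8"
      using quad_packet_lt_1(1)[OF ee R c, of x] lt R by (simp add: e_def field_simps)
    have P1: "cmod (packet (flat_deriv p) R c e w x) \<le> B1" for w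
      unfolding cmod_packet by (rule flat_quad_bound[OF B1(2) ee R c])
    have P2: "cmod (packet (flat_deriv (flat_deriv p)) R c e w x) \<le> B2" for w
      unfolding cmod_packet by (rule flat_quad_bound[OF B2(2) ee R c])
    have n: "\<bar>2 - 2 * real CARD('n)\<bar> \<le> 2 + 2 * real CARD('n)" by simp
    have tri: "cmod (- 2 * \<i> * of_real s * P - of_real t * P + of_real u * Q)
      \<le> \<bar>2 * s\<bar> * cmod P + \<bar>t\<bar> * cmod P + \<bar>u\<bar> * cmod Q" for s t u P Q
      by (rule order_trans[OF norm_triangle_ineq add_mono[OF order_trans[OF norm_triangle_ineq4]]])
        (simp_all add: norm_mult abs_mult)
    show ?thesis
      unfolding wave_packet[OF that]
      unfolding C_def e_def[symmetric] q_def[symmetric]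
      by (rule order_trans[OF tri]) (intro add_mono mult_mono xe P1 P2 n q B1 B2 norm_ge_zero | simp)+
  qed
  then show ?thesis using that by blast
qed

section \<open>A bump function and its Fourier transform\<close>

text \<open>The coefficient 4 confines the support to radius 1/2. The same bump serves as the
  spatial cutoff at the origin and, with centre R w, as the frequency window.\<close>

definition bump :: "'a::euclidean_space \<Rightarrow> 'a \<Rightarrow> real" where
  "bump z x = flat 1 (1 - quad 4 z 0 0 x)"

lemma bump_altdef: "bump z x = flat 1 (1 - 4 * (norm (x - z))\<^sup>2)"
  by (simp add: bump_def quad_def power2_norm_eq_inner)

lemma bump_shift: "bump z x = bump 0 (x - z)"
  by (simp add: bump_altdef)

lemma flat_1_le_1: "flat 1 t \<le> 1"
  by (simp add: flat_def)

lemma bump_nonneg: "0 \<le> bump z x" and bump_le_1: "bump z x \<le> 1"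
  by (simp_all add: bump_def flat_1_nonneg flat_1_le_1)

lemma bump_eq_0: "norm (x - z) > 1/2 \<Longrightarrow> bump z x = 0"
proof -
  assume "norm (x - z) > 1/2"
  then have "(1/2)\<^sup>2 \<le> (norm (x - z))\<^sup>2"
    by (intro power_mono) auto
  then show ?thesis by (simp add: bump_altdef power2_eq_square)
qed

lemma bump_elementary: "elementary (\<lambda>x. of_real (bump z x))"
  unfolding bump_def by (rule elementary.flat)

lemma bump_borel [measurable]: "bump z \<in> borel_measurable borel"
proof -
  have "(\<lambda>x. Re (of_real (bump z x))) \<in> borel_measurable borel"
    using elementary_borel[OF bump_elementary[of z]] by measurable
  then show ?thesis by simp
qed

lemma bump_test_function: "(\<lambda>x. of_real (bump z x)) \<in> test_functions"
proof (rule elementary_test_functionI[OF bump_elementary])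
  fix x
  assume "complex_of_real (bump z x) \<noteq> 0"
  then have "norm (x - z) \<le> 1/2"
    using bump_eq_0[of x z] by (auto simp: not_less[symmetric])
  then show "norm x \<le> norm z + 1/2"
    using norm_triangle_sub[of x z] by linarith
qed

lemma bump_support:
  fixes z :: "'a::euclidean_space"
  assumes "g \<in> borel_measurable borel" "\<And>x. cmod (g x) \<le> B"
  shows "integrable lborel (\<lambda>x. of_real (bump z x) * g x)" "(\<lambda>x. of_real (bump z x) * g x) \<in> L2"
    "(LINT x|lborel. (cmod (of_real (bump z x) * g x))\<^sup>2) \<le> B\<^sup>2 * measure lborel (cball (0::'a) (1/2))"
proof -
  note [measurable] = assms(1)
  have meas: "(\<lambda>x. of_real (bump z x) * g x) \<in> borel_measurable borel"
    by measurable
  have zero: "of_real (bump z x) * g x = 0" if "x \<notin> cball z (1/2)" for x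
    using that by (simp add: dist_norm norm_minus_commute bump_eq_0)
  have bd: "cmod (of_real (bump z x) * g x) \<le> B" for x
    using mult_mono[OF bump_le_1[of z x] assms(2)[of x]] by (simp add: norm_mult bump_nonneg)
  have fin: "emeasure lborel (cball z (1/2)) < \<infinity>"
    using emeasure_lborel_cball_finite by auto
  note * = bounded_finite_support_integrable[OF meas zero bd _ fin]
  show "integrable lborel (\<lambda>x. of_real (bump z x) * g x)" "(\<lambda>x. of_real (bump z x) * g x) \<in> L2"
    using * by auto
  show "(LINT x|lborel. (cmod (of_real (bump z x) * g x))\<^sup>2) \<le> B\<^sup>2 * measure lborel (cball (0::'a) (1/2))"
    using *(3) by (simp add: content_cball)
qed

lemma bump_integrable: "integrable lborel (bump z)"
  using bump_support(1)[of "\<lambda>_. 1" 1 z] integrable_Re by fastforce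

definition bump_mass :: "'a::euclidean_space itself \<Rightarrow> real" where
  "bump_mass _ = (LINT x|lborel. bump (0::'a) x)"

lemma bump_mass_pos: "bump_mass TYPE('a::euclidean_space) > 0"
proof -
  \<comment> \<open>On this ball 1 - 4 |x|^2 is at least 3/4, the source of
    \<open>flat 1 (3/4)\<close>.\<close>
  let ?A = "cball (0::'a) (1/4)"
  have fin: "emeasure lborel ?A < \<infinity>"
    by (rule emeasure_compact_finite) simp
  have "0 < flat 1 (3/4) * measure lborel ?A"
    by (intro mult_pos_pos flat_1_pos) auto
  also have "\<dots> = (LINT x|lborel. flat 1 (3/4) * indicator ?A x)"
    using fin by simp
  also have "\<dots> \<le> (LINT x|lborel. bump (0::'a) x)"
  proof (rule integral_mono)
    show "integrable lborel (\<lambda>x::'a. flat 1 (3/4) * indicator ?A x)"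
      by (intro integrable_mult_right integrable_real_indicator fin) simp
    fix x :: 'a
    have "flat 1 (3/4) \<le> bump 0 x" if "norm x \<le> 1/4"
    proof -
      have "(norm x)\<^sup>2 \<le> (1/4)\<^sup>2"
        by (intro power_mono that) auto
      then show ?thesis
        unfolding bump_altdef by (intro flat_1_mono) (simp add: power2_eq_square)
    qed
    then show "flat 1 (3/4) * indicator ?A x \<le> bump 0 x"
      by (auto simp: bump_nonneg split: split_indicator)
  qed (rule bump_integrable)
  finally show ?thesis by (simp add: bump_mass_def)
qed

section \<open>Size, regularity and positivity of the Fourier transform of the bump\<close>

definition bump_fourier :: "'a::euclidean_space \<Rightarrow> complex" where
  "bump_fourier = fourier (\<lambda>x. of_real (bump 0 x))"

lemma exp_inner_borel [measurable]:
  "(\<lambda>\<xi>. exp (- \<i> * of_real (x \<bullet> \<xi>))) \<in> borel_measurable borel"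
  by (intro borel_measurable_continuous_onI continuous_intros)

lemma fourier_inner_commute: "fourier \<phi> x = (LINT \<xi>|lborel. exp (- \<i> * of_real (x \<bullet> \<xi>)) * \<phi> \<xi>)"
  by (simp add: fourier_def inner_commute)

lemmas bump_fourier_altdef = fun_cong[OF bump_fourier_def, unfolded fourier_inner_commute]

lemma bump_fourier_integrable:
  "integrable lborel (\<lambda>\<xi>. exp (- \<i> * of_real (x \<bullet> \<xi>)) * of_real (bump z \<xi>))"
proof -
  have "integrable lborel (\<lambda>\<xi>. of_real (bump z \<xi>) * exp (- \<i> * of_real (x \<bullet> \<xi>)))"
    by (rule bump_support(1)[where B = 1]) auto
  then show ?thesis by (simp only: mult.commute)
qed

lemma fourier_bump:
  "fourier (\<lambda>\<xi>. of_real (bump z \<xi>)) x = exp (- \<i> * of_real (x \<bullet> z)) * bump_fourier (x :: 'a::euclidean_space)"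
proof -
  have "fourier (\<lambda>\<xi>. of_real (bump z \<xi>)) x =
      (LINT \<xi>|lborel. exp (- \<i> * of_real (x \<bullet> (z + \<xi>))) * of_real (bump z (z + \<xi>)))"
    unfolding fourier_inner_commute by (rule lborel_integral_translate[symmetric]) measurable
  also have "\<dots> = (LINT \<xi>|lborel. exp (- \<i> * of_real (x \<bullet> z)) * (exp (- \<i> * of_real (x \<bullet> \<xi>)) * of_real (bump 0 \<xi>)))"
    by (intro Bochner_Integration.integral_cong refl)
      (simp add: bump_shift[of z] inner_add_right distrib_left exp_add[symmetric] mult.assoc[symmetric] exp_diff)
  also have "\<dots> = exp (- \<i> * of_real (x \<bullet> z)) * bump_fourier x"
    unfolding bump_fourier_altdef by (rule integral_mult_right_zero)
  finally show ?thesis .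
qed

lemma bump_fourier_bound: "cmod (bump_fourier (x :: 'a::euclidean_space)) \<le> bump_mass TYPE('a)"
  unfolding bump_fourier_altdef bump_mass_def
  by (rule Bochner_Integration.integral_norm_bound_integral[OF bump_fourier_integrable bump_integrable])
    (simp add: norm_mult bump_nonneg)

lemma cmod_exp_diff_le: "cmod (exp (- \<i> * of_real s) - exp (- \<i> * of_real t)) \<le> \<bar>s - t\<bar>"
proof -
  have "exp (- \<i> * of_real s) - exp (- \<i> * of_real t) = exp (- \<i> * of_real t) * (exp (\<i> * of_real (t - s)) - 1)"
    by (simp add: right_diff_distrib exp_add[symmetric])
  then have "cmod (exp (- \<i> * of_real s) - exp (- \<i> * of_real t)) = 2 * \<bar>sin ((t - s) / 2)\<bar>"
    by (simp only: norm_mult dist_exp_i_1) simp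
  also have "\<dots> \<le> \<bar>s - t\<bar>"
    using abs_sin_x_le_abs_x[of "(t - s) / 2"] by (simp add: abs_minus_commute)
  finally show ?thesis .
qed

text \<open>The kernel is Lipschitz in x with constant |\<xi>|, and the bump only sees |\<xi>| up to
  1/2.\<close>

lemma bump_fourier_lipschitz:
  "cmod (bump_fourier x - bump_fourier y) \<le> bump_mass TYPE('a) * norm (x - y :: 'a::euclidean_space)"
proof -
  have "bump_fourier x - bump_fourier y = (LINT \<xi>|lborel. exp (- \<i> * of_real (x \<bullet> \<xi>)) * of_real (bump 0 \<xi>)
      - exp (- \<i> * of_real (y \<bullet> \<xi>)) * of_real (bump 0 \<xi>))"
    unfolding bump_fourier_altdef
    by (intro Bochner_Integration.integral_diff[symmetric] bump_fourier_integrable)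
  also have "cmod \<dots> \<le> (LINT \<xi>|lborel. bump (0::'a) \<xi> * norm (x - y))"
  proof (rule Bochner_Integration.integral_norm_bound_integral)
    fix \<xi> :: 'a
    have "\<bar>x \<bullet> \<xi> - y \<bullet> \<xi>\<bar> \<le> norm (x - y)" if "norm \<xi> \<le> 1/2"
    proof -
      have "\<bar>x \<bullet> \<xi> - y \<bullet> \<xi>\<bar> \<le> norm (x - y) * norm \<xi>"
        using Cauchy_Schwarz_ineq2[of "x - y" \<xi>] by (simp add: inner_diff_left)
      also have "\<dots> \<le> norm (x - y) * 1"
        using that by (intro mult_left_mono) auto
      finally show ?thesis by simp
    qed
    then have "\<bar>x \<bullet> \<xi> - y \<bullet> \<xi>\<bar> * bump 0 \<xi> \<le> norm (x - y) * bump 0 \<xi>"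
      using bump_eq_0[of \<xi> 0] bump_nonneg[of 0 \<xi>] by (cases "norm \<xi> \<le> 1/2") (auto intro: mult_right_mono)
    moreover have "cmod (exp (- \<i> * of_real (x \<bullet> \<xi>)) * of_real (bump 0 \<xi>) - exp (- \<i> * of_real (y \<bullet> \<xi>)) * of_real (bump 0 \<xi>))
        = cmod (exp (- \<i> * of_real (x \<bullet> \<xi>)) - exp (- \<i> * of_real (y \<bullet> \<xi>))) * bump 0 \<xi>"
      by (simp add: left_diff_distrib[symmetric] norm_mult bump_nonneg del: mult_minus_left)
    moreover have "\<dots> \<le> \<bar>x \<bullet> \<xi> - y \<bullet> \<xi>\<bar> * bump 0 \<xi>"
      by (intro mult_right_mono cmod_exp_diff_le bump_nonneg)
    ultimately show "cmod (exp (- \<i> * of_real (x \<bullet> \<xi>)) * of_real (bump 0 \<xi>) - exp (- \<i> * of_real (y \<bullet> \<xi>)) * of_real (bump 0 \<xi>))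
        \<le> bump 0 \<xi> * norm (x - y)"
      by (simp only: mult.commute[of "bump 0 \<xi>"])
  qed (intro Bochner_Integration.integrable_diff bump_fourier_integrable, simp add: bump_integrable)
  also have "\<dots> = bump_mass TYPE('a) * norm (x - y)"
    by (simp add: bump_mass_def)
  finally show ?thesis .
qed

lemma bump_fourier_borel [measurable]: "bump_fourier \<in> borel_measurable borel"
proof (rule borel_measurable_continuous_onI)
  have "(bump_mass TYPE('a))-lipschitz_on UNIV (bump_fourier :: 'a \<Rightarrow> complex)"
    by (rule lipschitz_onI) (simp_all add: dist_norm bump_fourier_lipschitz less_imp_le[OF bump_mass_pos])
  then show "continuous_on UNIV (bump_fourier :: 'a \<Rightarrow> complex)"
    by (rule lipschitz_on_continuous_on)
qed

text \<open>With both x and \<xi> in the ball of radius 1/2 the phase stays in [-1, 1], where the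
  cosine is at least cos 1 > 0; hence no cancellation.\<close>

lemma bump_fourier_Re:
  fixes x :: "'a::euclidean_space"
  assumes "norm x \<le> 1/2"
  shows "Re (bump_fourier x) \<ge> cos 1 * bump_mass TYPE('a)"
proof -
  have re: "Re (exp (- \<i> * of_real t) * of_real k) = cos t * k" for t k :: real
    using Re_exp[of "- \<i> * of_real t"] by simp
  have "cos 1 * bump_mass TYPE('a) = (LINT \<xi>|lborel. cos 1 * bump (0::'a) \<xi>)"
    by (simp add: bump_mass_def)
  also have "\<dots> \<le> (LINT \<xi>|lborel. Re (exp (- \<i> * of_real (x \<bullet> \<xi>)) * of_real (bump 0 \<xi>)))"
  proof (rule integral_mono)
    fix \<xi> :: 'a
    have "cos 1 \<le> cos (x \<bullet> \<xi>)" if "norm \<xi> \<le> 1/2"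
    proof -
      have "\<bar>x \<bullet> \<xi>\<bar> \<le> norm x * norm \<xi>" by (rule Cauchy_Schwarz_ineq2)
      also have "\<dots> \<le> 1 * 1"
        using assms that by (intro mult_mono) auto
      finally have "cos 1 \<le> cos \<bar>x \<bullet> \<xi>\<bar>"
        using pi_gt3 by (intro cos_monotone_0_pi_le) auto
      then show ?thesis by simp
    qed
    then show "cos 1 * bump 0 \<xi> \<le> Re (exp (- \<i> * of_real (x \<bullet> \<xi>)) * of_real (bump 0 \<xi>))"
      unfolding re using bump_eq_0[of \<xi> 0] bump_nonneg[of 0 \<xi>]
      by (cases "norm \<xi> \<le> 1/2") (auto intro: mult_right_mono)
  qed (simp add: bump_integrable, intro integrable_Re bump_fourier_integrable)
  also have "\<dots> = Re (bump_fourier x)"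
    unfolding bump_fourier_altdef by (intro integral_Re bump_fourier_integrable)
  finally show ?thesis .
qed

section \<open>Localised wave packets near a frequency\<close>

text \<open>The derivative of the flat function vanishes where \<open>quad\<close> is at least 1, so
  the gradient, which grows linearly in general, has to be bounded only where \<open>quad\<close> is
  below 1.\<close>

lemma flat_quad_lipschitz:
  fixes z e :: "'a::euclidean_space"
  assumes B: "\<And>t. t \<le> 1 \<Longrightarrow> \<bar>flat (flat_deriv p) t\<bar> \<le> B" "B \<ge> 0"
    and quad: "\<And>x. quad a z c e x \<ge> 0"
    and grad: "\<And>x. quad a z c e x < 1 \<Longrightarrow> norm (quad_grad a z c e x) \<le> K" and "K \<ge> 0"
  shows "\<bar>flat p (1 - quad a z c e x) - flat p (1 - quad a z c e y)\<bar> \<le> B * K * norm (x - y)"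
proof -
  have "norm (flat p (1 - quad a z c e x) - flat p (1 - quad a z c e y)) \<le> B * K * norm (x - y)"
  proof (rule differentiable_bound[OF convex_UNIV flat_quad_has_derivative])
    fix u
    show "onorm (\<lambda>v. - flat (flat_deriv p) (1 - quad a z c e u) * (quad_grad a z c e u \<bullet> v)) \<le> B * K"
    proof (rule onorm_bound)
      fix v :: 'a
      have "\<bar>flat (flat_deriv p) (1 - quad a z c e u)\<bar> * norm (quad_grad a z c e u) \<le> B * K"
      proof (cases "quad a z c e u < 1")
        case True
        then show ?thesis
          using quad[of u] assms by (intro mult_mono B grad) auto
      qed (use assms in simp)
      then have "\<bar>flat (flat_deriv p) (1 - quad a z c e u)\<bar> * norm (quad_grad a z c e u) * norm v \<le> B * K * norm v"
        by (rule mult_right_mono) simp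
      moreover have "\<bar>flat (flat_deriv p) (1 - quad a z c e u)\<bar> * \<bar>quad_grad a z c e u \<bullet> v\<bar>
          \<le> \<bar>flat (flat_deriv p) (1 - quad a z c e u)\<bar> * (norm (quad_grad a z c e u) * norm v)"
        by (intro mult_left_mono Cauchy_Schwarz_ineq2) simp
      ultimately show "norm (- flat (flat_deriv p) (1 - quad a z c e u) * (quad_grad a z c e u \<bullet> v)) \<le> B * K * norm v"
        by (simp add: abs_mult mult.assoc)
    qed (use assms in simp)
  qed auto
  then show ?thesis by simp
qed

lemma mult_lipschitz:
  fixes f g :: "'a::real_normed_vector \<Rightarrow> complex"
  assumes "cmod (f x) \<le> A" "cmod (g y) \<le> B"
    and "cmod (f x - f y) \<le> K * norm (x - y)" "cmod (g x - g y) \<le> L * norm (x - y)"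
  shows "cmod (f x * g x - f y * g y) \<le> (A * L + K * B) * norm (x - y)"
proof -
  have nn: "0 \<le> A" "0 \<le> K * norm (x - y)"
    using assms norm_ge_zero order_trans by blast+
  have "f x * g x - f y * g y = f x * (g x - g y) + (f x - f y) * g y"
    by (simp add: algebra_simps)
  also have "cmod \<dots> \<le> cmod (f x) * cmod (g x - g y) + cmod (f x - f y) * cmod (g y)"
    by (metis norm_mult norm_triangle_ineq)
  also have "\<dots> \<le> A * (L * norm (x - y)) + (K * norm (x - y)) * B"
    using nn assms by (intro add_mono mult_mono) auto
  finally show ?thesis by (simp add: algebra_simps)
qed

text \<open>The amplitude left when a packet is multiplied by the spatial cutoff and by the Fourier
  transform of a frequency window, after both oscillating factors are split off.\<close>

definition profile :: "real \<Rightarrow> 'a::euclidean_space \<Rightarrow> 'a \<Rightarrow> complex" where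
  "profile c e x = of_real (flat 1 (1 - quad 1 0 c e x)) * (of_real (bump 0 x) * bump_fourier x)"

lemma profile_integrable:
  "integrable lborel (profile c e :: 'a::euclidean_space \<Rightarrow> complex)"
proof -
  have [measurable]: "(\<lambda>x::'a. complex_of_real (flat 1 (1 - quad 1 0 c e x))) \<in> borel_measurable borel"
    by (intro elementary_borel elementary.flat)
  have "integrable lborel (\<lambda>x::'a. of_real (bump 0 x) * (of_real (flat 1 (1 - quad 1 0 c e x)) * bump_fourier x))"
  proof (rule bump_support(1))
    fix x :: 'a
    show "cmod (of_real (flat 1 (1 - quad 1 0 c e x)) * bump_fourier x) \<le> bump_mass TYPE('a)"
      using mult_mono[OF flat_1_le_1[of "1 - quad 1 0 c e x"] bump_fourier_bound[of x]]
      by (simp add: norm_mult flat_1_nonneg)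
  qed measurable
  then show ?thesis
    by (simp add: profile_def [abs_def] mult_ac)
qed

text \<open>The point is that \<open>L\<close> does not depend on R: the envelope stretches along
  \<open>e\<close> as R grows, but its gradient keeps norm at most 2 on its support, and the cutoff
  keeps the domain of integration fixed.\<close>

lemma profile_oscillatory_bound:
  obtains L where "L \<ge> 0"
    "\<And>(e :: 'a::euclidean_space) w R c k. e \<bullet> e = 2 \<Longrightarrow> w \<bullet> w = 2 \<Longrightarrow> R \<ge> 1 \<Longrightarrow> c = (1 - 1 / R\<^sup>2) / 2 \<Longrightarrow> k \<noteq> 0 \<Longrightarrow>
      cmod (LINT x|lborel. exp (\<i> * of_real (k * (x \<bullet> w))) * profile c e x) \<le> L / \<bar>k\<bar>"
proof -
  obtain B where B: "B \<ge> 0" "\<And>t. t \<le> 1 \<Longrightarrow> \<bar>flat (flat_deriv 1) t\<bar> \<le> B"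
    using flat_bounded by blast
  let ?m = "bump_mass TYPE('a)"
  have m: "0 < ?m" by (rule bump_mass_pos)
  \<comment> \<open>Two applications of \<open>mult_lipschitz\<close>: envelope, bump and
    \<open>bump_fourier\<close> have bounds 1, 1, \<open>?m\<close> and Lipschitz constants 2 B, 4
    B, \<open>?m\<close>.\<close>
  define K where "K = 1 * (1 * ?m + (B * 4) * ?m) + (B * 2) * ?m"
  define L where "L = K * pi * measure lborel (cball (0::'a) (1/2))"
  have K: "K \<ge> 0" using B m by (simp add: K_def)
  show ?thesis
  proof (rule that[of L])
    show "L \<ge> 0" using K by (simp add: L_def)
    fix e w :: 'a and R c k :: real
    assume e: "e \<bullet> e = 2" and w: "w \<bullet> w = 2" and R: "R \<ge> 1" and c: "c = (1 - 1 / R\<^sup>2) / 2" and k: "k \<noteq> 0"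
    have quad_nonneg: "quad 1 0 c e x \<ge> 0" for x
    proof -
      have "(x \<bullet> e)\<^sup>2 / (2 * R\<^sup>2) \<ge> 0" by simp
      then show ?thesis
        using quad_packet_identities(1,2)[OF e _ c, of x] R by linarith
    qed
    have grad: "norm (quad_grad 1 0 c e x) \<le> 2" if "quad 1 0 c e x < 1" for x
    proof -
      have "R\<^sup>2 \<ge> 1" using R by simp
      then have "(norm (quad_grad 1 0 c e x))\<^sup>2 \<le> 2\<^sup>2"
        using quad_packet_identities(4)[OF e _ c, of x] R that by (simp add: power2_norm_eq_inner)
      then show ?thesis by (rule power2_le_imp_le) simp
    qed
    have lip1: "cmod (of_real (flat 1 (1 - quad 1 0 c e x)) - of_real (flat 1 (1 - quad 1 0 c e y)))
        \<le> (B * 2) * norm (x - y)" for x y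
      using flat_quad_lipschitz[OF B(2,1) quad_nonneg grad, of x y]
      by (simp only: of_real_diff[symmetric] norm_of_real)
    have bump_grad: "norm (quad_grad 4 (0::'a) 0 0 x) \<le> 4" if "quad 4 0 0 0 x < 1" for x :: 'a
    proof -
      have "(norm x)\<^sup>2 \<le> (1/2)\<^sup>2"
        unfolding power2_norm_eq_inner using that by (simp add: quad_def power2_eq_square)
      then have "norm x \<le> 1/2" by (rule power2_le_imp_le) simp
      then show ?thesis by (simp add: quad_grad_def)
    qed
    have lip2: "cmod (of_real (bump 0 x) - of_real (bump 0 y)) \<le> (B * 4) * norm (x - y)" for x y :: 'a
      using flat_quad_lipschitz[OF B(2,1) _ bump_grad, of x y]
      unfolding bump_def by (simp only: of_real_diff[symmetric] norm_of_real) (simp add: quad_def)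
    have bd: "cmod (of_real (bump 0 x)) \<le> 1" "cmod (of_real (flat 1 t)) \<le> 1"
      "cmod (of_real (bump 0 x) * bump_fourier x) \<le> ?m" for x :: 'a and t
      using bump_le_1[of 0 x] flat_1_le_1[of t] mult_mono[OF bump_le_1[of 0 x] bump_fourier_bound[of x]]
      by (simp_all add: bump_nonneg flat_1_nonneg norm_mult)
    have lip: "cmod (profile c e x - profile c e y) \<le> K * norm (x - y)" for x y
      unfolding profile_def K_def
      by (intro mult_lipschitz bd lip1 lip2 bump_fourier_bound bump_fourier_lipschitz)
    have "cmod (LINT x|lborel. exp (\<i> * of_real (k * (x \<bullet> w))) * profile c e x)
        \<le> K * pi / (\<bar>k\<bar> * norm w) * measure lborel (cball (0::'a) (1/2))"
    proof (rule oscillatory_integral_bound[OF profile_integrable _ lip _ k])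
      show "w \<noteq> 0" using w by auto
      show "profile c e x = 0" if "1/2 < norm x" for x
        using bump_eq_0[of x 0] that by (simp add: profile_def)
    qed
    also have "\<dots> = L / \<bar>k\<bar> / norm w"
      by (simp add: L_def)
    also have "\<dots> \<le> L / \<bar>k\<bar> / 1"
    proof (rule divide_left_mono)
      show "1 \<le> norm w" using w by (simp add: norm_eq_sqrt_inner)
    qed (use \<open>L \<ge> 0\<close> w in \<open>auto intro: divide_nonneg_nonneg\<close>)
    finally show "cmod (LINT x|lborel. exp (\<i> * of_real (k * (x \<bullet> w))) * profile c e x) \<le> L / \<bar>k\<bar>"
      by simp
  qed
qed

text \<open>On the support of the bump, the envelope and the real part of
  \<open>bump_fourier\<close> exceed positive constants independent of R, so the real part of the
  integrand never cancels.\<close>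

lemma profile_integral_lower_bound:
  obtains d where "d > 0"
    "\<And>(e :: 'a::euclidean_space) R c. e \<bullet> e = 2 \<Longrightarrow> R \<ge> 1 \<Longrightarrow> c = (1 - 1 / R\<^sup>2) / 2 \<Longrightarrow>
      d \<le> cmod (LINT x|lborel. profile c e x)"
proof -
  let ?m = "bump_mass TYPE('a)"
  \<comment> \<open>For |x| up to 1/2 the quadratic form is at most 1/4, whence
    \<open>flat 1 (3/4)\<close>; the other factor comes from \<open>bump_fourier_Re\<close>.
    Integrating the remaining bump contributes one more \<open>?m\<close>.\<close>
  define k where "k = flat 1 (3/4) * (cos 1 * ?m)"
  have cos1: "0 < cos (1::real)" using pi_gt3 by (intro cos_gt_zero_pi) auto
  have k: "0 < k"
    unfolding k_def by (intro mult_pos_pos flat_1_pos cos1 bump_mass_pos) simp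
  show ?thesis
  proof (rule that[of "k * ?m"])
    show "0 < k * ?m" by (intro mult_pos_pos k bump_mass_pos)
    fix e :: 'a and R c :: real
    assume e: "e \<bullet> e = 2" and R: "R \<ge> 1" and c: "c = (1 - 1 / R\<^sup>2) / 2"
    have "k * ?m = (LINT x|lborel. k * bump (0::'a) x)"
      by (simp add: bump_mass_def)
    also have "\<dots> \<le> (LINT x|lborel. Re (profile c e x))"
    proof (rule integral_mono)
      fix x :: 'a
      show "k * bump 0 x \<le> Re (profile c e x)"
      proof (cases "norm x \<le> 1/2")
        case True
        have "1 / R\<^sup>2 \<le> 1" using R by (simp add: divide_le_eq_1)
        then have "0 \<le> c * (x \<bullet> e)\<^sup>2" by (simp add: c)
        then have "quad 1 0 c e x \<le> (norm x)\<^sup>2"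
          by (simp add: quad_def power2_norm_eq_inner)
        also have "\<dots> \<le> (1/2)\<^sup>2"
          by (intro power_mono True) auto
        finally have "flat 1 (3/4) \<le> flat 1 (1 - quad 1 0 c e x)"
          by (intro flat_1_mono) (simp add: power2_eq_square)
        then have "k \<le> flat 1 (1 - quad 1 0 c e x) * Re (bump_fourier x)"
          unfolding k_def using bump_fourier_Re[OF True] cos1 bump_mass_pos[where ?'a = 'a]
          by (intro mult_mono flat_1_nonneg) auto
        then have "k * bump 0 x \<le> flat 1 (1 - quad 1 0 c e x) * Re (bump_fourier x) * bump 0 x"
          by (intro mult_right_mono bump_nonneg)
        then show ?thesis by (simp add: profile_def mult_ac)
      next
        case False
        then show ?thesis using bump_eq_0[of x 0] by (simp add: profile_def)
      qed
    qed (simp add: bump_integrable, intro integrable_Re profile_integrable)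
    also have "\<dots> = Re (LINT x|lborel. profile c e x)"
      by (intro integral_Re profile_integrable)
    also have "\<dots> \<le> cmod (LINT x|lborel. profile c e x)"
      by (rule complex_Re_le_cmod)
    finally show "k * ?m \<le> cmod (LINT x|lborel. profile c e x)" .
  qed
qed

text \<open>A window centred at S w has a Fourier transform modulated by exp(- i S x . w), so only
  the frequency difference R - S remains: no oscillation for S = R, and decay otherwise.\<close>

lemma packet_bump_fourier_integral:
  "(LINT x|lborel. packet 1 R c e w x * (of_real (bump 0 x) * fourier (\<lambda>\<xi>. of_real (bump (S *\<^sub>R w) \<xi>)) x)) =
    (LINT x|lborel. exp (\<i> * of_real ((R - S) * (x \<bullet> w))) * profile c e x)"
proof (intro Bochner_Integration.integral_cong refl)
  fix x
  have "exp (\<i> * of_real ((R - S) * (x \<bullet> w))) =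
      exp (\<i> * of_real (x \<bullet> (R *\<^sub>R w))) * exp (- \<i> * of_real (x \<bullet> (S *\<^sub>R w)))"
    unfolding exp_add[symmetric] by (rule arg_cong[where f = exp]) (simp add: algebra_simps)
  then show "packet 1 R c e w x * (of_real (bump 0 x) * fourier (\<lambda>\<xi>. of_real (bump (S *\<^sub>R w) \<xi>)) x) =
      exp (\<i> * of_real ((R - S) * (x \<bullet> w))) * profile c e x"
    unfolding fourier_bump packet_def profile_def by (simp only: mult_ac)
qed

section \<open>Sobolev regularity tested on a frequency window\<close>

lemma japanese_bracket_lower_bound:
  assumes w: "w \<bullet> w = 2" and R: "R \<ge> 0" and \<xi>: "norm (\<xi> - R *\<^sub>R w) \<le> 1/2"
  shows "R \<le> japanese_bracket \<xi>"
proof -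
  have le: "norm (R *\<^sub>R w) \<le> norm \<xi> + 1/2"
    using \<xi> norm_triangle_sub[of "R *\<^sub>R w" \<xi>] by (simp add: norm_minus_commute)
  have "2 * R\<^sup>2 = (norm (R *\<^sub>R w))\<^sup>2"
    unfolding power2_norm_eq_inner by (simp add: w power2_eq_square)
  also have "\<dots> \<le> (norm \<xi> + 1/2)\<^sup>2"
    by (intro power_mono le) auto
  \<comment> \<open>The length sqrt 2 of \<open>w\<close> leaves room to absorb the displacement by
    1/2.\<close>
  also have "\<dots> \<le> 2 * (1 + (norm \<xi>)\<^sup>2)"
    using zero_le_power2[of "norm \<xi> - 1/2"] by (simp add: power2_eq_square algebra_simps)
  finally have "R\<^sup>2 \<le> 1 + (norm \<xi>)\<^sup>2" by simp
  then show ?thesis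
    unfolding japanese_bracket_def by (rule real_le_rsqrt)
qed

text \<open>On the window around R w the weight is at most R^-s. The rest is a pairing of
  \<open>h\<close> with a translate of one fixed bump, hence bounded uniformly in R.\<close>

lemma sobolev_pairing_bound:
  fixes h :: "'a::euclidean_space \<Rightarrow> complex"
  assumes h: "h \<in> L2" and s: "s \<ge> 0"
  obtains H where "\<And>R w. R \<ge> 1 \<Longrightarrow> w \<bullet> w = 2 \<Longrightarrow>
    cmod (distr_of_fun (\<lambda>\<xi>. of_real (japanese_bracket \<xi> powr (- s)) * h \<xi>) (\<lambda>\<xi>. of_real (bump (R *\<^sub>R w) \<xi>)))
      \<le> R powr (- s) * H"
proof -
  define H where "H = ((LINT x|lborel. (cmod (h x))\<^sup>2) + measure lborel (cball (0::'a) (1/2))) / 2"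
  have "cmod (distr_of_fun (\<lambda>\<xi>. of_real (japanese_bracket \<xi> powr (- s)) * h \<xi>) (\<lambda>\<xi>. of_real (bump (R *\<^sub>R w) \<xi>)))
      \<le> R powr (- s) * H" if R: "R \<ge> 1" and w: "w \<bullet> w = 2" for R w
  proof -
    let ?b = "\<lambda>\<xi>::'a. complex_of_real (bump (R *\<^sub>R w) \<xi>)"
    have b: "?b \<in> L2" "(LINT x|lborel. (cmod (?b x))\<^sup>2) \<le> measure lborel (cball (0::'a) (1/2))"
      using bump_support(2,3)[of "\<lambda>_. 1" 1 "R *\<^sub>R w"] by simp_all
    note hb = L2_mult[OF h b(1)]
    have [measurable]: "h \<in> borel_measurable borel"
      by (rule L2_borel[OF h])
    have le: "cmod (of_real (japanese_bracket \<xi> powr (- s)) * h \<xi> * ?b \<xi>) \<le> R powr (- s) * cmod (h \<xi> * ?b \<xi>)" for \<xi>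
    proof (cases "norm (\<xi> - R *\<^sub>R w) \<le> 1/2")
      case True
      have "japanese_bracket \<xi> powr (- s) \<le> R powr (- s)"
        using japanese_bracket_lower_bound[OF w _ True] R s by (intro powr_mono2') auto
      from mult_right_mono[OF this, of "cmod (h \<xi> * ?b \<xi>)"] show ?thesis
        by (simp add: norm_mult mult.assoc)
    next
      case False
      then show ?thesis using bump_eq_0[of \<xi> "R *\<^sub>R w"] by simp
    qed
    have int: "integrable lborel (\<lambda>\<xi>. R powr (- s) * cmod (h \<xi> * ?b \<xi>))"
      by (intro integrable_mult_right integrable_norm hb)
    have [measurable]: "japanese_bracket \<in> borel_measurable (borel :: 'a measure)"
      unfolding japanese_bracket_def [abs_def] by measurable
    have int': "integrable lborel (\<lambda>\<xi>. of_real (japanese_bracket \<xi> powr (- s)) * h \<xi> * ?b \<xi>)"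
      by (rule integrable_dominated[OF int _ le]) measurable
    have "cmod (distr_of_fun (\<lambda>\<xi>. of_real (japanese_bracket \<xi> powr (- s)) * h \<xi>) ?b)
        \<le> (LINT \<xi>|lborel. R powr (- s) * cmod (h \<xi> * ?b \<xi>))"
      unfolding distr_of_fun_def by (rule Bochner_Integration.integral_norm_bound_integral[OF int' int le])
    also have "\<dots> = R powr (- s) * (LINT \<xi>|lborel. cmod (h \<xi> * ?b \<xi>))"
      by (rule integral_mult_right_zero)
    also have "\<dots> \<le> R powr (- s) * H"
      using hb(2) b(2) by (intro mult_left_mono) (auto simp: H_def)
    finally show ?thesis .
  qed
  then show ?thesis using that by blast
qed

text \<open>Distinct powers of M are at least M^k / 2 away from M^k, so every off-diagonal integral
  is at most 2 L / M^k. The weights sum to 4/3, and 8/3 is rounded up to 4.\<close>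

lemma lacunary_series_lower_bound:
  fixes I :: "nat \<Rightarrow> complex" and M :: real
  assumes sums: "(\<lambda>j. (1/4) ^ j * (of_real (s j) * I j)) sums S"
    and s: "\<And>j. 0 \<le> s j" "\<And>j. s j \<le> 1" and M: "M \<ge> 2" and L: "L \<ge> 0"
    and off: "\<And>j. j \<noteq> k \<Longrightarrow> cmod (I j) \<le> L / \<bar>M ^ j - M ^ k\<bar>"
    and diag: "d \<le> cmod (I k)"
  shows "(1/4) ^ k * s k * d \<le> cmod S + 4 * L / M ^ k"
proof -
  define a where "a = (\<lambda>j. (1/4) ^ j * (of_real (s j) * I j))"
  have norm_a: "cmod (a j) = (1/4) ^ j * (s j * cmod (I j))" for j
    using s by (simp add: a_def norm_mult norm_power norm_divide)
  have gap: "M ^ k / 2 \<le> \<bar>M ^ j - M ^ k\<bar>" if "j \<noteq> k" for j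
  proof (cases "j < k")
    case True
    then have "M ^ Suc j \<le> M ^ k" using M by (intro power_increasing) auto
    moreover have "2 * M ^ j \<le> M * M ^ j" using M by (intro mult_right_mono) auto
    ultimately show ?thesis unfolding power_Suc by linarith
  next
    case False
    then have "M ^ Suc k \<le> M ^ j" using M that by (intro power_increasing) auto
    moreover have "2 * M ^ k \<le> M * M ^ k" using M by (intro mult_right_mono) auto
    moreover have "0 \<le> M ^ k" using M by simp
    ultimately show ?thesis unfolding power_Suc by linarith
  qed
  have Mk: "0 < M ^ k" using M by simp
  have "cmod (S - a k) \<le> 1 / (1 - 1/4) * (2 * L / M ^ k)"
  proof (rule norm_sums_le)
    show "(\<lambda>j. a j - (if j = k then a j else 0)) sums (S - a k)"
      using sums unfolding a_def[symmetric] by (intro sums_diff sums_single)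
    show "(\<lambda>j. (1/4) ^ j * (2 * L / M ^ k)) sums (1 / (1 - 1/4) * (2 * L / M ^ k))"
      by (intro sums_mult2 geometric_sums) simp
    show "cmod (a j - (if j = k then a j else 0)) \<le> (1/4) ^ j * (2 * L / M ^ k)" for j
    proof (cases "j = k")
      case False
      have "cmod (I j) \<le> L / \<bar>M ^ j - M ^ k\<bar>" by (rule off[OF False])
      also have "\<dots> \<le> L / (M ^ k / 2)"
        using gap[OF False] Mk L by (intro divide_left_mono mult_pos_pos) linarith+
      finally have "s j * cmod (I j) \<le> 1 * (2 * L / M ^ k)"
        using s by (intro mult_mono) (auto simp: mult.commute)
      from mult_left_mono[OF this, of "(1/4) ^ j"] show ?thesis
        using False by (simp add: norm_a)
    qed (use L Mk in simp)
  qed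
  also have "\<dots> \<le> 4 * L / M ^ k"
    using L Mk by (simp add: field_simps)
  finally have "cmod (S - a k) \<le> 4 * L / M ^ k" .
  moreover have "(1/4) ^ k * (s k * d) \<le> cmod (a k)"
    unfolding norm_a using s diag by (intro mult_left_mono) auto
  moreover have "cmod (a k) \<le> cmod S + cmod (S - a k)"
    using norm_triangle_sub[of "a k" S] by (simp add: norm_minus_commute)
  ultimately show ?thesis by (simp add: mult.assoc)
qed

section \<open>A lacunary sum of packets outside the local Sobolev space\<close>

theorem theorem1p2:
  fixes P :: "(real \<times> (real^'n) \<Rightarrow> complex) rel" and \<epsilon> :: real
  assumes "self_adjoint_extension_of_wave P"
    and "\<epsilon> > 0"
  shows "\<exists>f\<in>L2. \<exists>u. (f, u) \<in> resolvent P \<i> \<and> distr_of_fun u \<notin> sobolev_loc (1/2 + \<epsilon>)"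
proof -
  have P: "self_adjoint P" "\<And>\<phi>. \<phi> \<in> test_functions \<Longrightarrow> (\<phi>, wave \<phi>) \<in> P"
    using assms(1) by (auto simp: self_adjoint_extension_of_wave_def)
  then have P_L2: "P \<subseteq> L2 \<times> L2" by (simp add: self_adjoint_def)
  obtain b :: "real^'n" where b: "b \<in> Basis" using nonempty_Basis by blast
  define e w where "e = (1 :: real, b)" and "w = (1 :: real, - b)"
  have e: "e \<bullet> e = 2" and w: "w \<bullet> w = 2"
    using b by (simp_all add: e_def w_def)
  \<comment> \<open>Chosen so that both \<open>M powr (- 1/2)\<close> and
    \<open>M powr (- \<epsilon>)\<close> are at most 1/16, whose powers decay faster than the
    weights (1/4)^k.\<close>
  define M where "M = 256 powr (1 + 1 / \<epsilon>)"
  \<comment> \<open>The power \<open>\<mu> ^ j\<close> is R_j^(-1/2), which normalises packet j in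
    \<open>L2\<close> up to a constant.\<close>
  define \<mu> where "\<mu> = M powr (- 1/2)"
  define R where "R = (\<lambda>j::nat. M ^ j)"
  define c where "c = (\<lambda>j. (1 - 1 / (R j)\<^sup>2) / 2)"
  define v where "v = (\<lambda>j. packet 1 (R j) (c j) e w)"
  have "256 powr 1 \<le> M"
    unfolding M_def using assms(2) by (intro powr_mono) auto
  then have M: "256 \<le> M" by simp
  have \<mu>_pos: "0 < \<mu>" using M by (simp add: \<mu>_def)
  have \<mu>2: "\<mu>\<^sup>2 = 1 / M"
  proof -
    have "\<mu>\<^sup>2 = M powr (- 1)"
      unfolding \<mu>_def power2_eq_square powr_add[symmetric] by simp
    then show ?thesis using M by (simp only: powr_neg_one)
  qed
  have "\<mu>\<^sup>2 \<le> (1/16)\<^sup>2"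
    unfolding \<mu>2 using M by (simp add: power2_eq_square divide_le_eq)
  then have \<mu>: "\<mu> \<le> 1/16"
    by (rule power2_le_imp_le) simp
  have \<nu>: "M powr (- \<epsilon>) \<le> 1/16"
  proof -
    have "M powr (- \<epsilon>) = 256 powr (- \<epsilon> - 1)"
      unfolding M_def powr_powr
      by (rule arg_cong[where f = "(powr) 256"]) (use assms(2) in \<open>simp add: field_simps\<close>)
    also have "\<dots> \<le> 256 powr (- 1)"
      using assms(2) by (intro powr_mono) auto
    also have "\<dots> = 1/256" by (rule powr_neg_one) simp
    finally show ?thesis by simp
  qed
  have R: "R j \<ge> 1" for j using M by (simp add: R_def)
  have s2: "(\<mu> ^ j)\<^sup>2 * R j = 1" for j
  proof -
    have "(\<mu> ^ j)\<^sup>2 * R j = (\<mu>\<^sup>2 * M) ^ j"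
      by (simp only: R_def power_mult_distrib power_mult[symmetric] mult.commute[of j 2])
    then show ?thesis using \<mu>2 M by simp
  qed
  have s01: "0 \<le> \<mu> ^ j" "\<mu> ^ j \<le> 1" for j
    using \<mu>_pos \<mu> by (simp_all add: power_le_one)
  have c_eq: "c j = (1 - 1 / (R j)\<^sup>2) / 2" for j
    by (simp add: c_def)
  have v_test: "v j \<in> test_functions" for j
    unfolding v_def by (rule packet_test_function[OF e R c_eq])
  have mem: "(v j, wave (v j)) \<in> P" for j
    by (intro P v_test)
  obtain C where C: "\<And>j x. cmod (wave (v j) x) \<le> C"
    using wave_packet_bound[of 1] b R unfolding v_def e_def w_def c_def by metis
  define V where "V = measure lborel (cball (0 :: real \<times> (real^'n)) 2)"
  \<comment> \<open>A bounded function living on packet j has squared norm O(R_j) by the measure of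
    the tube, and the factor \<open>(\<mu> ^ j)\<^sup>2\<close> offsets exactly R_j. This serves for
    the packets and for their images under \<open>wave\<close>.\<close>
  have scaled_bounds: "(LINT x|lborel. (cmod (of_real (\<mu> ^ j) * g x))\<^sup>2) \<le> 7 * V * K\<^sup>2"
      "cmod (of_real (\<mu> ^ j) * g x) \<le> K"
    if g: "g \<in> L2" "\<And>x. cmod (g x) \<le> K" "\<And>x. quad 1 0 (c j) e x \<ge> 1 \<Longrightarrow> g x = 0" for g K j x
  proof -
    have "cmod (of_real (\<mu> ^ j) * g x) = \<mu> ^ j * cmod (g x)"
      using s01(1)[of j] by (simp add: norm_mult del: of_real_power)
    also have "\<dots> \<le> 1 * K"
      using s01 g(2) by (intro mult_mono) auto
    finally show "cmod (of_real (\<mu> ^ j) * g x) \<le> K" by simp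
    have zero: "g x = 0" if "x \<notin> tube (R j) e" for x
      using quad_packet_lt_1_in_tube[OF e R c_eq[of j], of x] g(3)[of x] that by fastforce
    have "(LINT x|lborel. (cmod (g x))\<^sup>2) \<le> K\<^sup>2 * measure lborel (tube (R j) e)"
      by (rule bounded_finite_support_integrable(3)[OF L2_borel[OF g(1)] zero g(2) tube_measure(1,2)[OF R]])
    also have "\<dots> \<le> K\<^sup>2 * (7 * R j * V)"
      using tube_measure(3)[OF R, of j e] by (intro mult_left_mono) (auto simp: V_def)
    finally have "(\<mu> ^ j)\<^sup>2 * (LINT x|lborel. (cmod (g x))\<^sup>2) \<le> (\<mu> ^ j)\<^sup>2 * (K\<^sup>2 * (7 * R j * V))"
      by (rule mult_left_mono) simp
    also have "\<dots> = ((\<mu> ^ j)\<^sup>2 * R j) * (7 * V * K\<^sup>2)"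
      by (simp only: mult_ac)
    also have "\<dots> = 7 * V * K\<^sup>2"
      by (simp only: s2 mult_1)
    finally have "(\<mu> ^ j)\<^sup>2 * (LINT x|lborel. (cmod (g x))\<^sup>2) \<le> 7 * V * K\<^sup>2" .
    moreover have "(LINT x|lborel. (cmod (of_real (\<mu> ^ j) * g x))\<^sup>2) = (LINT x|lborel. (\<mu> ^ j)\<^sup>2 * (cmod (g x))\<^sup>2)"
      using s01(1)[of j] by (simp add: norm_mult power_mult_distrib del: of_real_power)
    ultimately show "(LINT x|lborel. (cmod (of_real (\<mu> ^ j) * g x))\<^sup>2) \<le> 7 * V * K\<^sup>2"
      by (simp only: integral_mult_right_zero)
  qed
  have v_L2: "v j \<in> L2" "wave (v j) \<in> L2" for j
    using mem[of j] P_L2 by auto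
  have v_1: "cmod (v j x) \<le> 1" for j x
    unfolding v_def cmod_packet using flat_1_nonneg flat_1_le_1 by (simp add: abs_le_iff order_trans[of _ 0])
  have v_0: "v j x = 0" "wave (v j) x = 0" if "quad 1 0 (c j) e x \<ge> 1" for j x
  proof -
    show "v j x = 0" using that by (simp add: v_def packet_eq_0)
    show "wave (v j) x = 0"
      unfolding v_def e_def w_def wave_packet[OF b R c_eq]
      using that by (simp add: packet_eq_0 e_def)
  qed
  note v_bounds = scaled_bounds[OF v_L2(1) v_1 v_0(1)]
  note wave_bounds = scaled_bounds[OF v_L2(2) C v_0(2)]
  define U where "U = (\<lambda>x. \<Sum>j. (1/4) ^ j * (of_real (\<mu> ^ j) * v j x))"
  obtain W where UW: "(U, W) \<in> P"
    using self_adjoint_series[where s = "\<lambda>j. \<mu> ^ j" and \<phi> = v and \<psi> = "\<lambda>j. wave (v j)", OF P(1) mem v_bounds wave_bounds] unfolding U_def by blast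
  then have "(\<lambda>x. W x - \<i> * U x) \<in> L2"
    using P_L2 by (intro L2_diff_scaled) auto
  moreover have "(\<lambda>x. W x - \<i> * U x, U) \<in> resolvent P \<i>"
    using UW unfolding resolvent_def by blast
  moreover have "distr_of_fun U \<notin> sobolev_loc (1/2 + \<epsilon>)"
  proof
    assume "distr_of_fun U \<in> sobolev_loc (1/2 + \<epsilon>)"
    then have "mult_distr (\<lambda>x. of_real (bump 0 x)) (distr_of_fun U) \<in> sobolev (1/2 + \<epsilon>)"
      using bump_test_function unfolding sobolev_loc_def by blast
    then obtain g h where "L2_fourier g h" and eq: "\<forall>\<phi>\<in>schwartz_functions.
        fourier_distr (mult_distr (\<lambda>x. of_real (bump 0 x)) (distr_of_fun U)) \<phi> =
        distr_of_fun (\<lambda>\<xi>. of_real (japanese_bracket \<xi> powr (- (1/2 + \<epsilon>))) * h \<xi>) \<phi>"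
      unfolding sobolev_def mem_Collect_eq by (elim exE conjE) (rule that)
    then have h: "h \<in> L2" by (simp add: L2_fourier_def)
    obtain H where H: "\<And>R w. R \<ge> 1 \<Longrightarrow> w \<bullet> w = 2 \<Longrightarrow>
        cmod (distr_of_fun (\<lambda>\<xi>. of_real (japanese_bracket \<xi> powr (- (1/2 + \<epsilon>))) * h \<xi>)
          (\<lambda>\<xi>. of_real (bump (R *\<^sub>R w) \<xi>))) \<le> R powr (- (1/2 + \<epsilon>)) * H"
      by (rule sobolev_pairing_bound[OF h, of "1/2 + \<epsilon>"]) (use assms(2) in simp, erule that)
    \<comment> \<open>Evaluating the bound at R = 1 shows that \<open>H\<close> is
      nonnegative.\<close>
    have "0 \<le> 1 powr (- (1/2 + \<epsilon>)) * H"
      by (rule order_trans[OF norm_ge_zero H[OF _ w]]) simp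
    then have H0: "0 \<le> H" by simp
    obtain L where L: "L \<ge> 0" "\<And>R c k. R \<ge> 1 \<Longrightarrow> c = (1 - 1 / R\<^sup>2) / 2 \<Longrightarrow> k \<noteq> 0 \<Longrightarrow>
        cmod (LINT x|lborel. exp (\<i> * of_real (k * (x \<bullet> w))) * profile c e x) \<le> L / \<bar>k\<bar>"
      by (rule profile_oscillatory_bound[where ?'a = "real \<times> (real^'n)"]) (rule that, assumption, use e w in blast)
    obtain d where d: "d > 0" "\<And>R c. R \<ge> 1 \<Longrightarrow> c = (1 - 1 / R\<^sup>2) / 2 \<Longrightarrow>
        d \<le> cmod (LINT x|lborel. profile c e x)"
      by (rule profile_integral_lower_bound[where ?'a = "real \<times> (real^'n)"]) (rule that, assumption, use e in blast)
    \<comment> \<open>Testing with window k: the diagonal packet contributes at least (1/4)^k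
      \<mu>^k d, while the Sobolev bound and the other packets account for at most (4 L + H) \<mu>^k
      (1/16)^k.\<close>
    have "d \<le> (4 * L + H) * (1/4) ^ k" for k
    proof -
      define \<phi> where "\<phi> = (\<lambda>\<xi>. complex_of_real (bump (R k *\<^sub>R w) \<xi>))"
      define g where "g = (\<lambda>x. of_real (bump 0 x) * fourier \<phi> x)"
      define I where "I = (\<lambda>j. LINT x|lborel. v j x * g x)"
      define S where "S = (LINT x|lborel. U x * g x)"
      have I_eq: "I j = (LINT x|lborel. exp (\<i> * of_real ((R j - R k) * (x \<bullet> w))) * profile (c j) e x)" for j
        unfolding I_def g_def \<phi>_def v_def by (rule packet_bump_fourier_integral)
      have "g \<in> L2"
        unfolding g_def
      proof (rule bump_support(2))
        show "cmod (fourier \<phi> x) \<le> bump_mass TYPE(real \<times> (real^'n))" for x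
          unfolding \<phi>_def fourier_bump using bump_fourier_bound[of x] by (simp add: norm_mult)
        show "fourier \<phi> \<in> borel_measurable borel"
          unfolding \<phi>_def fourier_bump [abs_def]
          by (intro borel_measurable_times bump_fourier_borel borel_measurable_continuous_onI continuous_intros)
      qed
      then have "(\<lambda>j. (1/4) ^ j * (LINT x|lborel. (of_real (\<mu> ^ j) * v j x) * g x)) sums S"
        unfolding S_def U_def by (intro L2_series_bilinear[OF L2_mult_left[OF v_L2(1)] v_bounds])
      then have "(\<lambda>j. (1/4) ^ j * (of_real (\<mu> ^ j) * I j)) sums S"
        by (simp only: mult.assoc[of "of_real _"] integral_mult_right_zero I_def)
      then have "(1/4) ^ k * \<mu> ^ k * d \<le> cmod S + 4 * L / M ^ k"
      proof (rule lacunary_series_lower_bound[OF _ s01])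
        show "cmod (I j) \<le> L / \<bar>M ^ j - M ^ k\<bar>" if "j \<noteq> k" for j
        proof -
          have "M ^ j \<noteq> M ^ k" using that M by (simp add: power_inject_exp)
          then show ?thesis
            unfolding I_eq using L(2)[OF R c_eq[of j], of "R j - R k"] by (simp add: R_def)
        qed
        show "d \<le> cmod (I k)"
          unfolding I_eq using d(2)[OF R c_eq[of k]] by simp
      qed (use M L in auto)
      moreover have "cmod S \<le> R k powr (- (1/2 + \<epsilon>)) * H"
      proof -
        have "\<phi> \<in> schwartz_functions"
          unfolding \<phi>_def by (intro test_function_imp_schwartz bump_test_function)
        from bspec[OF eq this] have "S = distr_of_fun (\<lambda>\<xi>. of_real (japanese_bracket \<xi> powr (- (1/2 + \<epsilon>))) * h \<xi>) \<phi>"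
          unfolding S_def g_def by (simp add: fourier_distr_def mult_distr_def distr_of_fun_def)
        then show ?thesis
          using H[OF R w] by (simp add: \<phi>_def)
      qed
      \<comment> \<open>The exponent 1/2 is used up by the normalisation \<mu>^k of the packet; the
        excess \<epsilon> is what provides decay.\<close>
      moreover have "R k powr (- (1/2 + \<epsilon>)) = \<mu> ^ k * (M powr (- \<epsilon>)) ^ k"
        using M by (simp add: R_def \<mu>_def powr_realpow[symmetric] powr_powr powr_add[symmetric] algebra_simps)
      moreover have "4 * L / M ^ k = \<mu> ^ k * (4 * L * \<mu> ^ k)"
      proof -
        have "1 / M ^ k = \<mu> ^ k * \<mu> ^ k"
          using s2[of k] M by (simp add: R_def field_simps power2_eq_square)
        moreover have "4 * L / M ^ k = 4 * L * (1 / M ^ k)" by simp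
        ultimately show ?thesis by (simp only: mult_ac)
      qed
      ultimately have "\<mu> ^ k * ((1/4) ^ k * d) \<le> \<mu> ^ k * (4 * L * \<mu> ^ k + (M powr (- \<epsilon>)) ^ k * H)"
        by (simp add: algebra_simps)
      then have "(1/4) ^ k * d \<le> 4 * L * \<mu> ^ k + (M powr (- \<epsilon>)) ^ k * H"
        using \<mu>_pos by (simp add: mult_le_cancel_left_pos)
      also have "\<dots> \<le> 4 * L * (1/16) ^ k + (1/16) ^ k * H"
        using \<mu> \<nu> \<mu>_pos L H0 by (intro add_mono mult_left_mono mult_right_mono power_mono) auto
      also have "\<dots> = (1/4) ^ k * ((4 * L + H) * (1/4) ^ k)"
      proof -
        have "(1/16 :: real) ^ k = (1/4) ^ k * (1/4) ^ k"
          by (simp flip: power_mult_distrib)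
        then show ?thesis by (simp add: algebra_simps)
      qed
      finally show ?thesis by simp
    qed
    moreover have "(\<lambda>k. (4 * L + H) * (1/4) ^ k) \<longlonglongrightarrow> (4 * L + H) * 0"
      by (intro tendsto_intros LIMSEQ_power_zero) simp
    ultimately have "d \<le> (4 * L + H) * 0"
      by (intro LIMSEQ_le_const) auto
    then show False using d(1) by simp
  qed
  ultimately show ?thesis by blast
qed

end
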